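(* In the setting of a generic triple $(F,G,H)$ of decorated flags in an $m$-dimensional space $V$ with volume form $\omega$, for all nonnegative integers $a,b,c$ with $a+b+c=m$ and $(a,b,c)\notin\{(m,0,0),(0,m,0),(0,0,m)\}$, $$\Delta^\ast_{a,b,c}:=\langle\omega^\ast,\ \ast f_{(m-a)}\wedge\ast g_{(m-b)}\wedge\ast h_{(m-c)}\rangle=\Delta^b_{c,0,a}.$$ That is, the coordinate $\Delta_{a,b,c}$ of the dual configuration $(\ast F,\ast G,\ast H)$ equals $\Delta^b_{c,0,a}$.
   Context: $V^\ast$ is the dual space and $\omega^\ast$ the volume form on $V^\ast$ with $\langle\omega^\ast,\omega\rangle=1$, where $\langle\cdot,\cdot\rangle:\wedge^kV\times\wedge^kV^\ast\to\mathbb Q$ is $\langle v_1\wedge\cdots\wedge v_k,\phi_1\wedge\cdots\wedge\phi_k\rangle=\det(\langle v_i,\phi_j\rangle)$. The isomorphism $\ast:\wedge^kV\to\wedge^{m-k}V^\ast$ is defined by $\langle v,\ast u\rangle=\langle u\wedge v,\omega\rangle$ for $v\in\wedge^{m-k}V$. A decorated flag is $F_1\subset\cdots\subset F_{m-1}$ with nonzero $f_{(i)}\in\wedge^iF_i$; $f_{(0)}=1$, $f_{(m)}$ normalized by $\langle f_{(m)},\omega\rangle=1$; its dual $\ast F$ is the flag $F_{m-1}^\perp\subset\cdots\subset F_1^\perp$ in $V^\ast$ with decorations $\ast f_{(m-k)}$. For generic $(F,G)$ there is a basis $f_1,\dots,f_m$ with $f_k\in F_k\cap G_{m+1-k}$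 and $f_{(k)}=f_1\wedge\cdots\wedge f_k$; for generic $(G,H)$ a basis $h_1,\dots,h_m$ with $h_k\in G_{m+1-k}\cap H_k$ and $h_{(k)}=h_k\wedge\cdots\wedge h_1$. Put $f_{s,(k)}=f_{s+1}\wedge\cdots\wedge f_{s+k}$, $h_{(k),s}=h_{s+k}\wedge\cdots\wedge h_{s+1}$, and for $a'+b'+c'=m-s$ define $\Delta^s_{a',b',c'}:=\langle f_{s,(a')}\wedge g_{(b')}\wedge h_{(c'),s},\omega_s\rangle$ where $\omega_s$ is the volume form on $G_{m-s}$ with $\langle g_{(m-s)},\omega_s\rangle=\langle f_{(s)}\wedge g_{(m-s)},\omega\rangle\langle g_{(m-s)}\wedge h_{(s)},\omega\rangle$. *)

theory Defs
  imports "Jordan_Normal_Form.Determinant"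
begin

text \<open>Conventions. V = Q^m, vectors are rat vec of dimension m; a covector phi
acts on v by the dot product, so V^* is also represented by rat vec of dimension m.
The volume form omega on V is given by a nonzero scalar cw:
<v_1 ^ ... ^ v_m, omega> = cw * det[v_1 ... v_m].
A decomposable k-vector v_1 ^ ... ^ v_k is represented by the list [v_1,...,v_k];
k-forms on V (elements of wedge^k V^*) are represented as alternating k-linear
functionals (rat vec list => rat), identified via <v_1^...^v_k, psi> = psi [v_1..v_k].\<close>

definition vecs_in :: "nat \<Rightarrow> rat vec list \<Rightarrow> bool" where
  "vecs_in m vs \<longleftrightarrow> set vs \<subseteq> carrier_vec m"

text \<open>Pairing <u_1^...^u_k, phi_1^...^phi_k> = det(<u_i,phi_j>).\<close>
definition pair_wedge :: "rat vec list \<Rightarrow> rat vec list \<Rightarrow> rat" where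
  "pair_wedge us phis = det (mat (length us) (length us) (\<lambda>(i,j). us ! i \<bullet> phis ! j))"

text \<open>Equality of decomposable k-vectors in wedge^k V (tested against all of wedge^k V^*).\<close>
definition wedge_eq :: "nat \<Rightarrow> rat vec list \<Rightarrow> rat vec list \<Rightarrow> bool" where
  "wedge_eq m us vs \<longleftrightarrow> length us = length vs \<and>
     (\<forall>phis. length phis = length us \<and> vecs_in m phis \<longrightarrow> pair_wedge us phis = pair_wedge vs phis)"

text \<open>Nonzero k-vector.\<close>
definition wedge_nonzero :: "nat \<Rightarrow> rat vec list \<Rightarrow> bool" where
  "wedge_nonzero m us \<longleftrightarrow> (\<exists>phis. length phis = length us \<and> vecs_in m phis \<and> pair_wedge us phis \<noteq> 0)"

text \<open>Linear span membership.\<close>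
definition in_span :: "nat \<Rightarrow> rat vec list \<Rightarrow> rat vec \<Rightarrow> bool" where
  "in_span m vs v \<longleftrightarrow> v \<in> carrier_vec m \<and> (\<exists>x \<in> carrier_vec (length vs). v = mat_of_cols m vs *\<^sub>v x)"

text \<open><v_1 ^ ... ^ v_m, omega>.\<close>
definition volV :: "nat \<Rightarrow> rat \<Rightarrow> rat vec list \<Rightarrow> rat" where
  "volV m cw vs = cw * det (mat_of_cols m vs)"

text \<open>A decorated flag: D i represents the decoration f_(i) in wedge^i F_i, where
F_i = span (D i) is i-dimensional (f_(i) nonzero), F_i subset F_(i+1),
f_(0) = 1 (empty wedge), and <f_(m), omega> = 1.\<close>
definition dflag :: "nat \<Rightarrow> rat \<Rightarrow> (nat \<Rightarrow> rat vec list) \<Rightarrow> bool" where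
  "dflag m cw D \<longleftrightarrow>
     (\<forall>i\<le>m. length (D i) = i \<and> vecs_in m (D i) \<and> wedge_nonzero m (D i)) \<and>
     (\<forall>i<m. \<forall>v\<in>set (D i). in_span m (D (Suc i)) v) \<and>
     volV m cw (D m) = 1"

text \<open>Generic triple: F_a + G_b + H_c = V (direct) for all a+b+c=m, i.e.
<f_(a) ^ g_(b) ^ h_(c), omega> is nonzero. (This contains genericity of the pairs.)\<close>
definition generic_triple :: "nat \<Rightarrow> rat \<Rightarrow> (nat \<Rightarrow> rat vec list) \<Rightarrow> (nat \<Rightarrow> rat vec list)
    \<Rightarrow> (nat \<Rightarrow> rat vec list) \<Rightarrow> bool" where
  "generic_triple m cw F G H \<longleftrightarrow>
     (\<forall>a b c. a + b + c = m \<longrightarrow> volV m cw (F a @ G b @ H c) \<noteq> 0)"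

text \<open>The basis f_1..f_m (stored as fl ! (k-1) = f_k) attached to the pair (F,G):
f_k in F_k \<inter> G_(m+1-k) and f_(k) = f_1 ^ ... ^ f_k.\<close>
definition basis_FG :: "nat \<Rightarrow> (nat \<Rightarrow> rat vec list) \<Rightarrow> (nat \<Rightarrow> rat vec list) \<Rightarrow> rat vec list \<Rightarrow> bool" where
  "basis_FG m F G fl \<longleftrightarrow> length fl = m \<and> vecs_in m fl \<and>
     (\<forall>k\<in>{1..m}. in_span m (F k) (fl ! (k-1)) \<and> in_span m (G (m+1-k)) (fl ! (k-1)) \<and>
        wedge_eq m (take k fl) (F k))"

text \<open>The basis h_1..h_m (hl ! (k-1) = h_k) attached to the pair (G,H):
h_k in G_(m+1-k) \<inter> H_k and h_(k) = h_k ^ ... ^ h_1.\<close>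
definition basis_GH :: "nat \<Rightarrow> (nat \<Rightarrow> rat vec list) \<Rightarrow> (nat \<Rightarrow> rat vec list) \<Rightarrow> rat vec list \<Rightarrow> bool" where
  "basis_GH m G H hl \<longleftrightarrow> length hl = m \<and> vecs_in m hl \<and>
     (\<forall>k\<in>{1..m}. in_span m (G (m+1-k)) (hl ! (k-1)) \<and> in_span m (H k) (hl ! (k-1)) \<and>
        wedge_eq m (rev (take k hl)) (H k))"

text \<open>The volume form on the subspace W = span gs (gs a basis of W) taking value K on
the wedge of gs: evaluated on ws (vectors of W) it is K * det of the coordinate
matrix of ws with respect to gs.\<close>
definition vol_sub :: "nat \<Rightarrow> rat vec list \<Rightarrow> rat \<Rightarrow> rat vec list \<Rightarrow> rat" where
  "vol_sub m gs K ws = K * det (THE M. M \<in> carrier_mat (length gs) (length ws) \<and>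
      mat_of_cols m ws = mat_of_cols m gs * M)"

text \<open>Delta^s_{a',b',c'} = <f_{s,(a')} ^ g_(b') ^ h_{(c'),s}, omega_s>, with omega_s the volume
form on G_(m-s) with <g_(m-s), omega_s> = <f_(s)^g_(m-s),omega> <g_(m-s)^h_(s),omega>.\<close>
definition Delta_s :: "nat \<Rightarrow> rat \<Rightarrow> (nat \<Rightarrow> rat vec list) \<Rightarrow> (nat \<Rightarrow> rat vec list) \<Rightarrow> (nat \<Rightarrow> rat vec list)
    \<Rightarrow> rat vec list \<Rightarrow> rat vec list \<Rightarrow> nat \<Rightarrow> nat \<Rightarrow> nat \<Rightarrow> nat \<Rightarrow> rat" where
  "Delta_s m cw F G H fl hl s a' b' c' =
     vol_sub m (G (m - s)) (volV m cw (F s @ G (m - s)) * volV m cw (G (m - s) @ H s))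
       (take a' (drop s fl) @ G b' @ rev (take c' (drop s hl)))"

text \<open>Hodge-type isomorphism: for u in wedge^k V, *u in wedge^(m-k) V^* is the form
with <v, *u> = <u ^ v, omega>.\<close>
definition star :: "nat \<Rightarrow> rat \<Rightarrow> rat vec list \<Rightarrow> (rat vec list \<Rightarrow> rat)" where
  "star m cw us = (\<lambda>vs. volV m cw (us @ vs))"

text \<open>Wedge product of a p-form alpha and a q-form beta (convention making
phi_1 ^...^ phi_k evaluate to det(<v_i,phi_j>)): sum over (p,q)-shuffles.\<close>
definition wedgeF :: "nat \<Rightarrow> (rat vec list \<Rightarrow> rat) \<Rightarrow> (rat vec list \<Rightarrow> rat) \<Rightarrow> (rat vec list \<Rightarrow> rat)" where
  "wedgeF p alpha beta = (\<lambda>vs. \<Sum>S\<in>{S. S \<subseteq> {..<length vs} \<and> card S = p}.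
      (-1::rat) ^ (\<Sum>S - p * (p - 1) div 2) * alpha (nths vs S) * beta (nths vs (- S)))"

text \<open><omega^*, psi> for an m-form psi, where omega^* = (1/cw) e_1 ^ ... ^ e_m in wedge^m V
is the volume form on V^* with <omega^*, omega> = 1.\<close>
definition pair_omega_star :: "nat \<Rightarrow> rat \<Rightarrow> (rat vec list \<Rightarrow> rat) \<Rightarrow> rat" where
  "pair_omega_star m cw psi = psi (unit_vecs m) / cw"

text \<open>Delta^*_{a,b,c} = <omega^*, *f_(m-a) ^ *g_(m-b) ^ *h_(m-c)>.\<close>
definition Delta_dual :: "nat \<Rightarrow> rat \<Rightarrow> (nat \<Rightarrow> rat vec list) \<Rightarrow> (nat \<Rightarrow> rat vec list) \<Rightarrow> (nat \<Rightarrow> rat vec list)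
    \<Rightarrow> nat \<Rightarrow> nat \<Rightarrow> nat \<Rightarrow> rat" where
  "Delta_dual m cw F G H a b c = pair_omega_star m cw
     (wedgeF (a + b) (wedgeF a (star m cw (F (m - a))) (star m cw (G (m - b)))) (star m cw (H (m - c))))"

end

theory Submission
  imports Defs
begin

text \<open>
  Write \<open>\<alpha> = *f_{(m-a)}\<close>, \<open>\<beta> = *g_{(m-b)}\<close>, \<open>\<gamma> = *h_{(m-c)}\<close>. Each of them is a form
  \<open>\<langle>u_{(k)} \<and> -, \<omega>\<rangle>\<close>, so it vanishes as soon as one of its arguments lies in the corresponding
  flag subspace. Evaluate the top-degree form \<open>(\<alpha> \<and> \<beta>) \<and> \<gamma>\<close> on the list
  \<open>h_{(a),b}, h_{(b)}, f_{b,(c)}\<close>: as \<open>h_{(a),b}\<close> lies in \<open>G_{m-b}\<close> and \<open>f_{b,(c)}\<close> in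
  \<open>F_{m-a} \<inter> G_{m-b}\<close>, all shuffle terms but one vanish, leaving
  \<open>\<alpha>(h_{(a),b}) \<beta>(h_{(b)}) \<gamma>(f_{b,(c)})\<close>, where \<open>\<gamma>(f_{b,(c)})\<close> is the volume of the list itself.
  On the other side, expanding \<open>f_{b,(c)} \<and> h_{(a),b}\<close> in the basis \<open>g_{(m-b)}\<close> of \<open>G_{m-b}\<close>
  gives \<open>\<Delta>^b_{c,0,a} = \<alpha>(h_{(a),b}) \<beta>(h_{(b)})\<close>. If the list is dependent, then
  \<open>F_{m-a} \<inter> G_{m-b} \<inter> H_{m-c}\<close> contains a nonzero vector, which makes both sides vanish.
\<close>

section \<open>Alternating multilinear forms\<close>

definition alternating :: "nat \<Rightarrow> nat \<Rightarrow> (rat vec list \<Rightarrow> rat) \<Rightarrow> bool" where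
  "alternating m n \<theta> \<longleftrightarrow>
    (\<forall>xs i u v. length xs = n \<longrightarrow> set xs \<subseteq> carrier_vec m \<longrightarrow> i < n \<longrightarrow>
       u \<in> carrier_vec m \<longrightarrow> v \<in> carrier_vec m \<longrightarrow>
       \<theta> (xs[i := u + v]) = \<theta> (xs[i := u]) + \<theta> (xs[i := v])) \<and>
    (\<forall>xs i u c. length xs = n \<longrightarrow> set xs \<subseteq> carrier_vec m \<longrightarrow> i < n \<longrightarrow> u \<in> carrier_vec m \<longrightarrow>
       \<theta> (xs[i := c \<cdot>\<^sub>v u]) = c * \<theta> (xs[i := u])) \<and>
    (\<forall>xs i. length xs = n \<longrightarrow> set xs \<subseteq> carrier_vec m \<longrightarrow> Suc i < n \<longrightarrow> xs ! i = xs ! Suc i \<longrightarrow>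
       \<theta> xs = 0)"

lemma alternatingI:
  assumes "\<And>xs i u v. length xs = n \<Longrightarrow> set xs \<subseteq> carrier_vec m \<Longrightarrow> i < n \<Longrightarrow>
      u \<in> carrier_vec m \<Longrightarrow> v \<in> carrier_vec m \<Longrightarrow>
      \<theta> (xs[i := u + v]) = \<theta> (xs[i := u]) + \<theta> (xs[i := v])"
    and "\<And>xs i u c. length xs = n \<Longrightarrow> set xs \<subseteq> carrier_vec m \<Longrightarrow> i < n \<Longrightarrow> u \<in> carrier_vec m \<Longrightarrow>
      \<theta> (xs[i := c \<cdot>\<^sub>v u]) = c * \<theta> (xs[i := u])"
    and "\<And>xs i. length xs = n \<Longrightarrow> set xs \<subseteq> carrier_vec m \<Longrightarrow> Suc i < n \<Longrightarrow>
      xs ! i = xs ! Suc i \<Longrightarrow> \<theta> xs = 0"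
  shows "alternating m n \<theta>"
  unfolding alternating_def using assms by blast

context
  fixes m n :: nat and \<theta> :: "rat vec list \<Rightarrow> rat"
  assumes alt: "alternating m n \<theta>"
begin

lemma alternating_add:
  "length xs = n \<Longrightarrow> set xs \<subseteq> carrier_vec m \<Longrightarrow> i < n \<Longrightarrow> u \<in> carrier_vec m \<Longrightarrow>
    v \<in> carrier_vec m \<Longrightarrow> \<theta> (xs[i := u + v]) = \<theta> (xs[i := u]) + \<theta> (xs[i := v])"
  using alt unfolding alternating_def by blast

lemma alternating_smult:
  "length xs = n \<Longrightarrow> set xs \<subseteq> carrier_vec m \<Longrightarrow> i < n \<Longrightarrow> u \<in> carrier_vec m \<Longrightarrow>
    \<theta> (xs[i := c \<cdot>\<^sub>v u]) = c * \<theta> (xs[i := u])"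
  using alt unfolding alternating_def by blast

lemma alternating_adjacent_eq:
  "length xs = n \<Longrightarrow> set xs \<subseteq> carrier_vec m \<Longrightarrow> Suc i < n \<Longrightarrow> xs ! i = xs ! Suc i \<Longrightarrow> \<theta> xs = 0"
  using alt unfolding alternating_def by blast

lemma alternating_zero_arg:
  assumes "length xs = n" "set xs \<subseteq> carrier_vec m" "i < n"
  shows "\<theta> (xs[i := 0\<^sub>v m]) = 0"
proof -
  have "(0::rat) \<cdot>\<^sub>v 0\<^sub>v m = 0\<^sub>v m" by auto
  then show ?thesis using alternating_smult[OF assms zero_carrier_vec, of 0] by simp
qed

lemma alternating_swap_if_vanishes:
  assumes len: "length xs = n" and car: "set xs \<subseteq> carrier_vec m"
    and ij: "i < n" "j < n" "i \<noteq> j"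
    and vanish: "\<And>ys. length ys = n \<Longrightarrow> set ys \<subseteq> carrier_vec m \<Longrightarrow> ys ! i = ys ! j \<Longrightarrow> \<theta> ys = 0"
  shows "\<theta> (xs[i := xs ! j, j := xs ! i]) = - \<theta> xs"
proof -
  define a b where "a = xs ! i" and "b = xs ! j"
  have ab: "a \<in> carrier_vec m" "b \<in> carrier_vec m" using car ij len unfolding a_def b_def by auto
  have car2: "set (xs[i := p, j := q]) \<subseteq> carrier_vec m"
    if "p \<in> carrier_vec m" "q \<in> carrier_vec m" for p q
    using car that by (auto dest!: subsetD[OF set_update_subset_insert])
  have len2: "length (xs[i := p, j := q]) = n" for p q using len by simp
  have add_i: "\<theta> (xs[i := p + q, j := r]) = \<theta> (xs[i := p, j := r]) + \<theta> (xs[i := q, j := r])"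
    if "p \<in> carrier_vec m" "q \<in> carrier_vec m" "r \<in> carrier_vec m" for p q r
  proof -
    have "xs[i := p, j := r, i := s] = xs[i := s, j := r]" for s
      using ij by (simp add: list_update_swap)
    then show ?thesis using alternating_add[OF len2 car2[OF that(1,3)] ij(1) that(1,2)] by simp
  qed
  have add_j: "\<theta> (xs[i := r, j := p + q]) = \<theta> (xs[i := r, j := p]) + \<theta> (xs[i := r, j := q])"
    if "p \<in> carrier_vec m" "q \<in> carrier_vec m" "r \<in> carrier_vec m" for p q r
    using alternating_add[OF len2 car2[OF that(3,1)] ij(2) that(1,2)] by simp
  have diag: "\<theta> (xs[i := p, j := p]) = 0" if "p \<in> carrier_vec m" for p
    by (rule vanish[OF len2 car2[OF that that]], insert len ij, auto simp: nth_list_update)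
  have "0 = \<theta> (xs[i := a + b, j := a + b])" using diag ab by auto
  also have "\<dots> = (\<theta> (xs[i := a, j := a]) + \<theta> (xs[i := a, j := b]))
      + (\<theta> (xs[i := b, j := a]) + \<theta> (xs[i := b, j := b]))"
    using add_i add_j ab by simp
  also have "\<dots> = \<theta> (xs[i := a, j := b]) + \<theta> (xs[i := b, j := a])"
    using diag ab by simp
  also have "xs[i := a, j := b] = xs" unfolding a_def b_def by simp
  finally show ?thesis unfolding a_def b_def by (simp add: eq_neg_iff_add_eq_0 add.commute)
qed

lemma alternating_repeated_arg_lt:
  "length xs = n \<Longrightarrow> set xs \<subseteq> carrier_vec m \<Longrightarrow> i < j \<Longrightarrow> j < n \<Longrightarrow> xs ! i = xs ! j \<Longrightarrow> \<theta> xs = 0"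
proof (induction "j - i" arbitrary: xs j)
  case 0
  then show ?case by simp
next
  case (Suc d)
  show ?case
  proof (cases "j = Suc i")
    case True
    then show ?thesis using alternating_adjacent_eq Suc.prems by auto
  next
    case False
    then obtain j' where j': "j = Suc j'" "i < j'" using Suc.prems by (cases j) auto
    \<comment> \<open>moving the repeated entry one step to the left reduces the distance\<close>
    define ys where "ys = xs[j' := xs ! j, j := xs ! j']"
    have "\<theta> ys = - \<theta> xs" unfolding ys_def
      by (rule alternating_swap_if_vanishes, insert Suc.prems j', auto intro: alternating_adjacent_eq)
    moreover have "\<theta> ys = 0"
    proof (rule Suc.hyps(1)[of j'])
      show "set ys \<subseteq> carrier_vec m" unfolding ys_def using Suc.prems j'
        by (auto dest!: subsetD[OF set_update_subset_insert])
    qed (insert Suc j', auto simp: ys_def)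
    ultimately show ?thesis by simp
  qed
qed

lemma alternating_repeated_arg:
  "length xs = n \<Longrightarrow> set xs \<subseteq> carrier_vec m \<Longrightarrow> i \<noteq> j \<Longrightarrow> i < n \<Longrightarrow> j < n \<Longrightarrow>
    xs ! i = xs ! j \<Longrightarrow> \<theta> xs = 0"
  by (metis linorder_neqE_nat alternating_repeated_arg_lt)

lemma alternating_swap:
  "length xs = n \<Longrightarrow> set xs \<subseteq> carrier_vec m \<Longrightarrow> i \<noteq> j \<Longrightarrow> i < n \<Longrightarrow> j < n \<Longrightarrow>
    \<theta> (xs[i := xs ! j, j := xs ! i]) = - \<theta> xs"
  by (rule alternating_swap_if_vanishes, auto intro: alternating_repeated_arg)

lemma alternating_sum_arg:
  assumes len: "length xs = n" and car: "set xs \<subseteq> carrier_vec m" and i: "i < n"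
    and fin: "finite J" and f: "\<And>j. j \<in> J \<Longrightarrow> f j \<in> carrier_vec m"
  shows "\<theta> (xs[i := vec m (\<lambda>r. \<Sum>j\<in>J. c j * f j $ r)]) = (\<Sum>j\<in>J. c j * \<theta> (xs[i := f j]))"
  using fin f
proof (induction J rule: finite_induct)
  case empty
  then show ?case using alternating_zero_arg[OF len car i] by (simp add: zero_vec_def)
next
  case (insert j J)
  have "(c j \<cdot>\<^sub>v f j) $ r = c j * f j $ r" if "r < m" for r
    using carrier_vecD[OF insert.prems[OF insertI1]] that by simp
  then have "vec m (\<lambda>r. \<Sum>j\<in>insert j J. c j * f j $ r) = c j \<cdot>\<^sub>v f j + vec m (\<lambda>r. \<Sum>j\<in>J. c j * f j $ r)"
    using insert by (intro eq_vecI) auto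
  then show ?case
    using alternating_add[OF len car i] alternating_smult[OF len car i] insert by simp
qed

lemma alternating_unit_vec_expansion:
  assumes "length xs = n" "set xs \<subseteq> carrier_vec m" "i < n" "v \<in> carrier_vec m"
  shows "\<theta> (xs[i := v]) = (\<Sum>j<m. v $ j * \<theta> (xs[i := unit_vec m j]))"
proof -
  have "vec m (\<lambda>r. \<Sum>j<m. v $ j * unit_vec m j $ r) = v"
    using assms(4) by (intro eq_vecI) (auto simp: if_distrib cong: if_cong)
  then show ?thesis using alternating_sum_arg[OF assms(1-3), of "{..<m}" "unit_vec m" "\<lambda>j. v $ j"] by simp
qed

end

lemma alternating_det: "alternating k k (\<lambda>zs. det (mat_of_cols k zs))"
proof (rule alternatingI)
  fix xs :: "rat vec list" and i
  assume len: "length xs = k" and i: "i < k"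
  have cof: "cofactor (mat_of_cols k (xs[i := u])) r i = cofactor (mat_of_cols k (xs[i := w])) r i" for u w r
  proof -
    have "mat_delete (mat_of_cols k (xs[i := u])) r i = mat_delete (mat_of_cols k (xs[i := w])) r i"
      unfolding mat_delete_def by (rule eq_matI, insert len, auto simp: mat_of_cols_index nth_list_update)
    then show ?thesis unfolding cofactor_def by simp
  qed
  \<comment> \<open>Laplace expansion along column \<open>i\<close> exhibits linearity in that column\<close>
  have lap: "det (mat_of_cols k (xs[i := u])) = (\<Sum>r<k. u $ r * cofactor (mat_of_cols k xs) r i)"
    if u: "u \<in> carrier_vec k" for u
  proof -
    have "det (mat_of_cols k (xs[i := u]))
        = (\<Sum>r<k. mat_of_cols k (xs[i := u]) $$ (r, i) * cofactor (mat_of_cols k (xs[i := u])) r i)"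
      by (rule laplace_expansion_column, insert len i, auto)
    also have "\<dots> = (\<Sum>r<k. u $ r * cofactor (mat_of_cols k (xs[i := xs ! i])) r i)"
      by (intro sum.cong refl, subst cof[of _ _ "xs ! i"], insert len i, auto simp: mat_of_cols_index)
    finally show ?thesis by simp
  qed
  show "det (mat_of_cols k (xs[i := u + v])) = det (mat_of_cols k (xs[i := u])) + det (mat_of_cols k (xs[i := v]))"
    if "u \<in> carrier_vec k" "v \<in> carrier_vec k" for u v
    using that by (simp add: lap sum.distrib[symmetric] algebra_simps)
  show "det (mat_of_cols k (xs[i := c \<cdot>\<^sub>v u])) = c * det (mat_of_cols k (xs[i := u]))"
    if "u \<in> carrier_vec k" for u c
    using that by (simp add: lap sum_distrib_left algebra_simps)
next
  fix xs :: "rat vec list" and i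
  assume "length xs = k" "set xs \<subseteq> carrier_vec k" "Suc i < k" "xs ! i = xs ! Suc i"
  then show "det (mat_of_cols k xs) = 0"
    by (intro det_identical_columns[of _ k i "Suc i"]) (auto simp: subsetD)
qed

lemma alternating_cong:
  assumes alt: "alternating m n \<theta>1"
    and eq: "\<And>xs. length xs = n \<Longrightarrow> set xs \<subseteq> carrier_vec m \<Longrightarrow> \<theta>1 xs = \<theta>2 xs"
  shows "alternating m n \<theta>2"
proof -
  have upd: "\<theta>2 (xs[i := u]) = \<theta>1 (xs[i := u])"
    if "length xs = n" "set xs \<subseteq> carrier_vec m" "u \<in> carrier_vec m" for xs i u
    using that by (intro eq[symmetric]) (auto dest!: subsetD[OF set_update_subset_insert])
  show ?thesis
    by (rule alternatingI, insert alternating_add[OF alt] alternating_smult[OF alt]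
        alternating_adjacent_eq[OF alt] upd eq, simp_all)
qed

lemma alternating_scale: "alternating m n \<theta> \<Longrightarrow> alternating m n (\<lambda>xs. c * \<theta> xs)"
  unfolding alternating_def by (simp add: algebra_simps)

lemma alternating_diff:
  "alternating m n \<theta>1 \<Longrightarrow> alternating m n \<theta>2 \<Longrightarrow> alternating m n (\<lambda>xs. \<theta>1 xs - \<theta>2 xs)"
  unfolding alternating_def by (simp add: algebra_simps)

lemma alternating_mult_mat_slice:
  assumes alt: "alternating k N \<theta>" and A: "A \<in> carrier_mat k m"
    and pre: "set pre \<subseteq> carrier_vec k" and post: "set post \<subseteq> carrier_vec k"
    and N: "N = length pre + n + length post"
  shows "alternating m n (\<lambda>xs. \<theta> (pre @ map ((*\<^sub>v) A) xs @ post))"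
proof -
  have upd: "pre @ map ((*\<^sub>v) A) (xs[i := u]) @ post = (pre @ map ((*\<^sub>v) A) xs @ post)[length pre + i := A *\<^sub>v u]"
    if "i < length xs" for xs :: "rat vec list" and i u
    using that by (simp add: map_update list_update_append)
  have len: "length (pre @ map ((*\<^sub>v) A) xs @ post) = N" if "length xs = n" for xs :: "rat vec list"
    using that N by simp
  have car: "set (pre @ map ((*\<^sub>v) A) xs @ post) \<subseteq> carrier_vec k"
    if "set xs \<subseteq> carrier_vec m" for xs :: "rat vec list"
    using that pre post A by auto
  show ?thesis
  proof (rule alternatingI)
    fix xs :: "rat vec list" and i and u v :: "rat vec"
    assume "length xs = n" "set xs \<subseteq> carrier_vec m" "i < n" "u \<in> carrier_vec m" "v \<in> carrier_vec m"
    then show "\<theta> (pre @ map ((*\<^sub>v) A) (xs[i := u + v]) @ post)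
        = \<theta> (pre @ map ((*\<^sub>v) A) (xs[i := u]) @ post) + \<theta> (pre @ map ((*\<^sub>v) A) (xs[i := v]) @ post)"
      using alternating_add[OF alt len car, of xs "length pre + i"] A N
      by (simp add: upd mult_add_distrib_mat_vec)
  next
    fix xs :: "rat vec list" and i and u :: "rat vec" and c
    assume "length xs = n" "set xs \<subseteq> carrier_vec m" "i < n" "u \<in> carrier_vec m"
    then show "\<theta> (pre @ map ((*\<^sub>v) A) (xs[i := c \<cdot>\<^sub>v u]) @ post) = c * \<theta> (pre @ map ((*\<^sub>v) A) (xs[i := u]) @ post)"
      using alternating_smult[OF alt len car, of xs "length pre + i"] A N
      by (simp add: upd mult_mat_vec)
  next
    fix xs :: "rat vec list" and i
    assume "length xs = n" "set xs \<subseteq> carrier_vec m" "Suc i < n" "xs ! i = xs ! Suc i"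
    then show "\<theta> (pre @ map ((*\<^sub>v) A) xs @ post) = 0"
      using alternating_adjacent_eq[OF alt len car, of xs "length pre + i"] N by (auto simp: nth_append)
  qed
qed

lemma alternating_slice:
  assumes alt: "alternating m N \<theta>" and "set pre \<subseteq> carrier_vec m" "set post \<subseteq> carrier_vec m"
    and "N = length pre + n + length post"
  shows "alternating m n (\<lambda>xs. \<theta> (pre @ xs @ post))"
proof (rule alternating_cong)
  show "alternating m n (\<lambda>xs. \<theta> (pre @ map ((*\<^sub>v) (1\<^sub>m m)) xs @ post))"
    by (rule alternating_mult_mat_slice[OF alt one_carrier_mat assms(2-4)])
  show "\<theta> (pre @ map ((*\<^sub>v) (1\<^sub>m m)) xs @ post) = \<theta> (pre @ xs @ post)" if "set xs \<subseteq> carrier_vec m" for xs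
    using that by (simp add: map_idI subset_iff)
qed

lemma alternating_volV:
  assumes "set pre \<subseteq> carrier_vec m" "set post \<subseteq> carrier_vec m" "length pre + n + length post = m"
  shows "alternating m n (\<lambda>xs. volV m cw (pre @ xs @ post))"
  unfolding volV_def
  by (rule alternating_scale, rule alternating_slice[OF alternating_det assms(1,2)], insert assms(3), simp)

lemma alternating_unit_vecs_perm_zero:
  assumes alt: "alternating m m \<delta>" and zero: "\<delta> (unit_vecs m) = 0"
    and "d \<le> m" "inj_on g {..<m}" "g ` {..<m} \<subseteq> {..<m}" "\<forall>i. i + d < m \<longrightarrow> g i = i"
  shows "\<delta> (map (\<lambda>i. unit_vec m (g i)) [0..<m]) = 0"
  using assms(3-)
proof (induction d arbitrary: g)
  case 0
  then have "map (\<lambda>i. unit_vec m (g i)) [0..<m] = (unit_vecs m :: rat vec list)"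
    unfolding unit_vecs_def by auto
  then show ?case using zero by simp
next
  case (Suc d)
  \<comment> \<open>\<open>g\<close> fixes everything below \<open>k\<close>; either it also fixes \<open>k\<close>, or one transposition makes it do so\<close>
  define k where "k = m - Suc d"
  have km: "k < m" "k + Suc d = m" using Suc.prems unfolding k_def by auto
  have below: "g i = i" if "i < k" for i using Suc.prems km that by auto
  have fix_to: "\<forall>i. i + d < m \<longrightarrow> h i = i" if "h k = k" "\<And>i. i < k \<Longrightarrow> h i = i" for h
  proof (intro allI impI)
    fix i assume "i + d < m"
    then have "i < k \<or> i = k" using km by linarith
    then show "h i = i" using that by auto
  qed
  show ?case
  proof (cases "g k = k")
    case True
    have "\<forall>i. i + d < m \<longrightarrow> g i = i" by (rule fix_to) (use True below in auto)
    then show ?thesis using Suc.IH[of g] Suc.prems by simp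
  next
    case False
    have "g ` {..<m} = {..<m}" by (rule endo_inj_surj, insert Suc.prems, auto)
    then obtain j where j: "j < m" "g j = k" using km by (metis imageE lessThan_iff)
    have "j \<noteq> k" using j False by auto
    then have kj: "k < j" using below[of j] j by (metis linorder_neqE_nat)
    define g' where "g' = (\<lambda>i. if i = k then g j else if i = j then g k else g i)"
    have "\<delta> (map (\<lambda>i. unit_vec m (g' i)) [0..<m]) = 0"
    proof (rule Suc.IH)
      show "inj_on g' {..<m}"
        using Suc.prems(2) j km kj unfolding g'_def inj_on_def by (metis lessThan_iff less_irrefl)
      show "g' ` {..<m} \<subseteq> {..<m}" using Suc.prems(3) j km unfolding g'_def by auto
      show "\<forall>i. i + d < m \<longrightarrow> g' i = i" by (rule fix_to, insert below kj j, auto simp: g'_def)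
    qed (insert Suc.prems, auto)
    moreover define xs :: "rat vec list" where "xs = map (\<lambda>i. unit_vec m (g' i)) [0..<m]"
    moreover have "map (\<lambda>i. unit_vec m (g i)) [0..<m] = xs[k := xs ! j, j := xs ! k]"
      unfolding xs_def g'_def by (rule nth_equalityI, insert j km kj, auto simp: nth_list_update)
    moreover have "\<delta> (xs[k := xs ! j, j := xs ! k]) = - \<delta> xs"
      by (rule alternating_swap[OF alt], insert j km kj, auto simp: xs_def)
    ultimately show ?thesis by simp
  qed
qed

lemma alternating_zero_on_unit_vec_lists:
  assumes alt: "alternating m m \<delta>" and zero: "\<delta> (unit_vecs m) = 0"
    and len: "length xs = m" and units: "\<forall>i<m. \<exists>j<m. xs ! i = unit_vec m j"
  shows "\<delta> xs = 0"
proof -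
  obtain g where g: "\<And>i. i < m \<Longrightarrow> g i < m \<and> xs ! i = unit_vec m (g i)" using units by metis
  have xs: "xs = map (\<lambda>i. unit_vec m (g i)) [0..<m]" by (rule nth_equalityI, insert g len, auto)
  show "\<delta> xs = 0"
  proof (cases "inj_on g {..<m}")
    case True
    then show ?thesis unfolding xs using g
      by (intro alternating_unit_vecs_perm_zero[OF alt zero le_refl]) auto
  next
    case False
    then obtain i j where "i < m" "j < m" "i \<noteq> j" "g i = g j" unfolding inj_on_def by auto
    then show ?thesis
      by (intro alternating_repeated_arg[OF alt len, of i j]) (auto simp: xs)
  qed
qed

lemma det_unit_vecs: "det (mat_of_cols m (unit_vecs m)) = (1::rat)"
proof -
  have "mat_of_cols m (unit_vecs m) = (1\<^sub>m m :: rat mat)"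
    by (rule eq_matI, auto simp: unit_vecs_def mat_of_cols_index)
  then show ?thesis by (metis det_one)
qed

lemma alternating_top_degree:
  assumes alt: "alternating m m \<phi>" and len: "length vs = m" and car: "set vs \<subseteq> carrier_vec m"
  shows "\<phi> vs = det (mat_of_cols m vs) * \<phi> (unit_vecs m)"
proof -
  define \<delta> where "\<delta> xs = \<phi> xs - det (mat_of_cols m xs) * \<phi> (unit_vecs m)" for xs
  have alt\<delta>: "alternating m m \<delta>" unfolding \<delta>_def
    by (rule alternating_diff[OF alt], subst mult.commute, rule alternating_scale[OF alternating_det])
  have zero: "\<delta> (unit_vecs m) = 0" unfolding \<delta>_def by (simp add: det_unit_vecs)
  \<comment> \<open>expand the entries one at a time in the standard basis\<close>
  have "\<delta> xs = 0" if "k \<le> m" "length xs = m" "set xs \<subseteq> carrier_vec m"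
      "\<forall>i. k \<le> i \<and> i < m \<longrightarrow> (\<exists>j<m. xs ! i = unit_vec m j)" for k xs
    using that
  proof (induction k arbitrary: xs)
    case 0
    then show ?case using alternating_zero_on_unit_vec_lists[OF alt\<delta> zero] by auto
  next
    case (Suc k)
    have "\<delta> (xs[k := unit_vec m j]) = 0" if "j < m" for j
      using Suc.prems that by (intro Suc.IH) (auto simp: nth_list_update dest!: subsetD[OF set_update_subset_insert])
    moreover have "xs ! k \<in> carrier_vec m" using Suc.prems by (auto intro: subsetD)
    then have "\<delta> xs = (\<Sum>j<m. xs ! k $ j * \<delta> (xs[k := unit_vec m j]))"
      using alternating_unit_vec_expansion[OF alt\<delta> Suc.prems(2,3), of k "xs ! k"] Suc.prems by auto
    ultimately show ?case by simp
  qed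
  from this[of m vs] show ?thesis using len car unfolding \<delta>_def by fastforce
qed

lemma mat_of_cols_mult_unit_vec:
  fixes us :: "rat vec list"
  assumes "set us \<subseteq> carrier_vec m" "j < length us"
  shows "mat_of_cols m us *\<^sub>v unit_vec (length us) j = us ! j"
proof (rule eq_vecI)
  have uj: "us ! j \<in> carrier_vec m" using assms by (simp add: subsetD)
  fix i assume "i < dim_vec (us ! j)"
  then have i: "i < m" using uj by simp
  have "(mat_of_cols m us *\<^sub>v unit_vec (length us) j) $ i = row (mat_of_cols m us) i $ j"
    using i assms(2) scalar_prod_right_unit[OF assms(2), of "row (mat_of_cols m us) i"] by simp
  then show "(mat_of_cols m us *\<^sub>v unit_vec (length us) j) $ i = us ! j $ i"
    using i assms(2) by (simp add: mat_of_cols_index)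
qed (use assms in \<open>auto dest!: nth_mem simp: subsetD\<close>)

lemma alternating_mult_mat_cols:
  assumes alt: "alternating m k \<theta>" and us: "length us = k" "set us \<subseteq> carrier_vec m"
    and cs: "length cs = k" "set cs \<subseteq> carrier_vec k"
  shows "\<theta> (map ((*\<^sub>v) (mat_of_cols m us)) cs) = det (mat_of_cols k cs) * \<theta> us"
proof -
  let ?U = "mat_of_cols m us"
  have "alternating k k (\<lambda>xs. \<theta> ([] @ map ((*\<^sub>v) ?U) xs @ []))"
    by (rule alternating_mult_mat_slice[OF alt], insert us, auto)
  from alternating_top_degree[OF this cs]
  have "\<theta> (map ((*\<^sub>v) ?U) cs) = det (mat_of_cols k cs) * \<theta> (map ((*\<^sub>v) ?U) (unit_vecs k))" by simp
  moreover have "map ((*\<^sub>v) ?U) (unit_vecs k) = us"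
    using us by (intro nth_equalityI) (auto simp: unit_vecs_def mat_of_cols_mult_unit_vec)
  ultimately show ?thesis by simp
qed

section \<open>The shuffle product of forms\<close>

lemma length_nths_subset: "S \<subseteq> {..<length xs} \<Longrightarrow> length (nths xs S) = card S"
proof -
  assume "S \<subseteq> {..<length xs}"
  then have "{i. i < length xs \<and> i \<in> S} = S" by auto
  then show ?thesis by (simp add: length_nths)
qed

lemma length_nths_Compl: "S \<subseteq> {..<length xs} \<Longrightarrow> length (nths xs (- S)) = length xs - card S"
proof -
  assume S: "S \<subseteq> {..<length xs}"
  have "{i. i < length xs \<and> i \<in> - S} = {..<length xs} - S" by auto
  then show ?thesis using S by (simp add: length_nths card_Diff_subset finite_subset)
qed

lemma set_nths_carrier: "set xs \<subseteq> carrier_vec m \<Longrightarrow> set (nths xs S) \<subseteq> carrier_vec m"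
  using set_nths_subset[of xs S] by (rule subset_trans)

lemma card_less_Suc:
  "card {j\<in>S. j < Suc i} = (if (0::nat) \<in> S then 1 else 0) + card {j. Suc j \<in> S \<and> j < i}"
proof -
  have "{j\<in>S. j < Suc i} = (if 0 \<in> S then {0} else {}) \<union> Suc ` {j. Suc j \<in> S \<and> j < i}"
    by (auto simp: image_iff less_Suc_eq_0_disj)
  then show ?thesis by (simp add: card_Un_disjoint card_image)
qed

lemma nths_list_update:
  "i < length xs \<Longrightarrow> nths (xs[i := u]) S =
    (if i \<in> S then (nths xs S)[card {j\<in>S. j < i} := u] else nths xs S)"
proof (induction xs arbitrary: i S)
  case (Cons x l)
  show ?case
  proof (cases i)
    case (Suc i')
    then show ?thesis using Cons card_less_Suc[of S i'] by (auto simp: nths_Cons list_update_append)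
  qed (simp add: nths_Cons)
qed simp

lemma nth_nths_card_less:
  "i \<in> S \<Longrightarrow> i < length xs \<Longrightarrow>
    card {j\<in>S. j < i} < length (nths xs S) \<and> nths xs S ! card {j\<in>S. j < i} = xs ! i"
proof (induction xs arbitrary: i S)
  case (Cons x l)
  show ?case
  proof (cases i)
    case (Suc i')
    then show ?thesis
      using Cons.prems Cons.IH[of i' "{j. Suc j \<in> S}"] card_less_Suc[of S i'] by (auto simp: nths_Cons nth_append)
  qed (use Cons.prems in \<open>simp add: nths_Cons\<close>)
qed simp

definition adj_swap :: "nat \<Rightarrow> nat \<Rightarrow> nat" where
  "adj_swap i j = (if j = i then Suc i else if j = Suc i then i else j)"

lemma adj_swap_adj_swap[simp]: "adj_swap i (adj_swap i j) = j"
  unfolding adj_swap_def by auto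

lemma vimage_adj_swap: "adj_swap i -` S = adj_swap i ` S"
  by (auto simp: image_iff) (metis adj_swap_adj_swap)+

lemma vimage_vimage_adj_swap[simp]: "adj_swap i -` adj_swap i -` S = S"
  by auto

lemma nths_vimage_adj_swap:
  "Suc i < length xs \<Longrightarrow> xs ! i = xs ! Suc i \<Longrightarrow> nths xs (adj_swap i -` S) = nths xs S"
proof (induction xs arbitrary: i S)
  case (Cons x l)
  show ?case
  proof (cases i)
    case 0
    then obtain y l' where "l = y # l'" using Cons.prems by (cases l) auto
    then show ?thesis using Cons.prems 0 by (auto simp: nths_Cons adj_swap_def)
  next
    case (Suc i')
    have "{j. Suc j \<in> adj_swap (Suc i') -` S} = adj_swap i' -` {j. Suc j \<in> S}"
      "0 \<in> adj_swap (Suc i') -` S \<longleftrightarrow> 0 \<in> S"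
      unfolding adj_swap_def by auto
    moreover have "nths l (adj_swap i' -` {j. Suc j \<in> S}) = nths l {j. Suc j \<in> S}"
      by (rule Cons.IH) (use Cons.prems Suc in auto)
    ultimately show ?thesis unfolding Suc by (simp only: nths_Cons)
  qed
qed simp

lemma power_minus_one_sum_adj_swap:
  assumes fin: "finite S" and "(i \<in> S) \<noteq> (Suc i \<in> S)"
  shows "(-1::rat) ^ \<Sum>(adj_swap i ` S) = - ((-1) ^ \<Sum>S)"
proof -
  have "inj_on (adj_swap i) S" by (metis inj_onI adj_swap_adj_swap)
  then have sum_image: "\<Sum>(adj_swap i ` S) = (\<Sum>j\<in>S. adj_swap i j)" by (simp add: sum.reindex)
  \<comment> \<open>exactly one of \<open>i\<close>, \<open>Suc i\<close> lies in \<open>S\<close>, so the index sum changes by one\<close>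
  show ?thesis
  proof (cases "i \<in> S")
    case True
    then have "(\<Sum>j\<in>S - {i}. adj_swap i j) = (\<Sum>j\<in>S - {i}. j)"
      using assms by (intro sum.cong) (auto simp: adj_swap_def)
    moreover have "(\<Sum>j\<in>S. adj_swap i j) = adj_swap i i + (\<Sum>j\<in>S - {i}. adj_swap i j)"
      "\<Sum>S = i + \<Sum>(S - {i})"
      using sum.remove[OF fin True, of "adj_swap i"] sum.remove[OF fin True, of "\<lambda>j. j"] by auto
    ultimately have "\<Sum>(adj_swap i ` S) = Suc (\<Sum>S)" unfolding sum_image by (simp add: adj_swap_def)
    then show ?thesis by simp
  next
    case False
    then have S: "Suc i \<in> S" using assms by auto
    then have "(\<Sum>j\<in>S - {Suc i}. adj_swap i j) = (\<Sum>j\<in>S - {Suc i}. j)"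
      using False by (intro sum.cong) (auto simp: adj_swap_def)
    moreover have "(\<Sum>j\<in>S. adj_swap i j) = adj_swap i (Suc i) + (\<Sum>j\<in>S - {Suc i}. adj_swap i j)"
      "\<Sum>S = Suc i + \<Sum>(S - {Suc i})"
      using sum.remove[OF fin S, of "adj_swap i"] sum.remove[OF fin S, of "\<lambda>j. j"] by auto
    ultimately have "Suc (\<Sum>(adj_swap i ` S)) = \<Sum>S" unfolding sum_image by (simp add: adj_swap_def)
    then show ?thesis by (metis power_Suc mult_minus1 minus_minus)
  qed
qed

lemma sum_lessThan_card_le: "finite (S::nat set) \<Longrightarrow> \<Sum>{..<card S} \<le> \<Sum>S"
proof (induction "card S" arbitrary: S)
  case (Suc n)
  define M where "M = Max S"
  have "S \<noteq> {}" using Suc by auto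
  then have M: "M \<in> S" "S \<subseteq> {..M}" unfolding M_def using Suc by auto
  have "card (S - {M}) = n" using Suc M by auto
  then have "\<Sum>{..<n} \<le> \<Sum>(S - {M})" using Suc.hyps(1)[of "S - {M}"] Suc.prems by auto
  moreover have "n \<le> M" using card_mono[OF _ M(2)] Suc by auto
  moreover have "\<Sum>S = M + \<Sum>(S - {M})" using M Suc.prems by (simp add: sum.remove)
  moreover have "\<Sum>{..<card S} = n + \<Sum>{..<n}" unfolding Suc.hyps(2)[symmetric] by simp
  ultimately show ?case by linarith
qed simp

text \<open>The truncated subtraction in the sign of \<open>wedgeF\<close> is harmless, as \<open>\<Sum>S \<ge> p(p-1)/2\<close>.\<close>

lemma power_minus_one_sum_shuffle:
  assumes "finite (S::nat set)" "card S = p"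
  shows "(-1::rat) ^ (\<Sum>S - p * (p - 1) div 2) = (-1) ^ \<Sum>S * (-1) ^ (p * (p - 1) div 2)"
proof -
  have "p * (p - 1) div 2 \<le> \<Sum>S"
    using sum_lessThan_card_le[OF assms(1)] Sum_Ico_nat[of 0 p] assms(2) by (simp add: lessThan_atLeast0)
  then have "(-1::rat) ^ \<Sum>S = (-1) ^ (\<Sum>S - p * (p - 1) div 2) * (-1) ^ (p * (p - 1) div 2)"
    by (simp add: power_add[symmetric])
  moreover have "(-1::rat) ^ (p * (p - 1) div 2) * (-1) ^ (p * (p - 1) div 2) = 1"
    by (simp add: power_add[symmetric])
  ultimately show ?thesis by (simp add: mult.assoc)
qed

definition shuffle_term :: "nat \<Rightarrow> (rat vec list \<Rightarrow> rat) \<Rightarrow> (rat vec list \<Rightarrow> rat) \<Rightarrow> rat vec list \<Rightarrow> nat set \<Rightarrow> rat" where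
  "shuffle_term p \<alpha> \<beta> xs S = (-1) ^ (\<Sum>S - p * (p - 1) div 2) * \<alpha> (nths xs S) * \<beta> (nths xs (- S))"

lemma wedgeF_eq_sum_shuffle_term:
  "wedgeF p \<alpha> \<beta> xs = (\<Sum>S\<in>{S. S \<subseteq> {..<length xs} \<and> card S = p}. shuffle_term p \<alpha> \<beta> xs S)"
  unfolding wedgeF_def shuffle_term_def by simp

lemma finite_shuffles: "finite {S. S \<subseteq> {..<n::nat} \<and> card S = p}"
  by (rule finite_subset[of _ "Pow {..<n}"]) auto

lemma shuffle_term_linear:
  assumes a: "alternating m p \<alpha>" and b: "alternating m q \<beta>"
    and len: "length xs = p + q" and car: "set xs \<subseteq> carrier_vec m"
    and S: "S \<subseteq> {..<p + q}" "card S = p" and k: "k < p + q"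
    and u: "u \<in> carrier_vec m" and v: "v \<in> carrier_vec m"
  shows "shuffle_term p \<alpha> \<beta> (xs[k := u + v]) S = shuffle_term p \<alpha> \<beta> (xs[k := u]) S + shuffle_term p \<alpha> \<beta> (xs[k := v]) S"
    and "shuffle_term p \<alpha> \<beta> (xs[k := c \<cdot>\<^sub>v u]) S = c * shuffle_term p \<alpha> \<beta> (xs[k := u]) S"
proof -
  have l1: "length (nths xs S) = p" using S len by (simp add: length_nths_subset)
  have l2: "length (nths xs (- S)) = q" using S len by (simp add: length_nths_Compl)
  have c: "set (nths xs S) \<subseteq> carrier_vec m" "set (nths xs (- S)) \<subseteq> carrier_vec m"
    using set_nths_carrier[OF car] by auto
  have kl: "k < length xs" using k len by simp
  \<comment> \<open>entry \<open>k\<close> lands in exactly one of the two factors, at the position counted by \<open>card\<close>\<close>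
  have "shuffle_term p \<alpha> \<beta> (xs[k := u + v]) S = shuffle_term p \<alpha> \<beta> (xs[k := u]) S + shuffle_term p \<alpha> \<beta> (xs[k := v]) S
     \<and> shuffle_term p \<alpha> \<beta> (xs[k := c \<cdot>\<^sub>v u]) S = c * shuffle_term p \<alpha> \<beta> (xs[k := u]) S"
  proof (cases "k \<in> S")
    case True
    define pos where "pos = card {j\<in>S. j < k}"
    have pos: "pos < p" using nth_nths_card_less[OF True kl] l1 unfolding pos_def by simp
    have "nths (xs[k := w]) S = (nths xs S)[pos := w]" "nths (xs[k := w]) (- S) = nths xs (- S)" for w
      using nths_list_update[OF kl] True unfolding pos_def by auto
    then show ?thesis unfolding shuffle_term_def
      using alternating_add[OF a l1 c(1) pos u v] alternating_smult[OF a l1 c(1) pos u, of c]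
      by (simp add: algebra_simps)
  next
    case False
    then have T: "k \<in> - S" by simp
    define pos where "pos = card {j\<in>- S. j < k}"
    have pos: "pos < q" using nth_nths_card_less[OF T kl] l2 unfolding pos_def by simp
    have "nths (xs[k := w]) (- S) = (nths xs (- S))[pos := w]" "nths (xs[k := w]) S = nths xs S" for w
      using nths_list_update[OF kl] False unfolding pos_def by auto
    then show ?thesis unfolding shuffle_term_def
      using alternating_add[OF b l2 c(2) pos u v] alternating_smult[OF b l2 c(2) pos u, of c]
      by (simp add: algebra_simps)
  qed
  then show "shuffle_term p \<alpha> \<beta> (xs[k := u + v]) S = shuffle_term p \<alpha> \<beta> (xs[k := u]) S + shuffle_term p \<alpha> \<beta> (xs[k := v]) S"
    and "shuffle_term p \<alpha> \<beta> (xs[k := c \<cdot>\<^sub>v u]) S = c * shuffle_term p \<alpha> \<beta> (xs[k := u]) S" by auto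
qed

lemma shuffle_term_zero_if_adjacent_together:
  assumes a: "alternating m p \<alpha>" and b: "alternating m q \<beta>"
    and len: "length xs = p + q" and car: "set xs \<subseteq> carrier_vec m"
    and S: "S \<subseteq> {..<p + q}" "card S = p" and i: "Suc i < p + q" "xs ! i = xs ! Suc i"
    and together: "(i \<in> S) = (Suc i \<in> S)"
  shows "shuffle_term p \<alpha> \<beta> xs S = 0"
proof -
  have l1: "length (nths xs S) = p" using S len by (simp add: length_nths_subset)
  have l2: "length (nths xs (- S)) = q" using S len by (simp add: length_nths_Compl)
  have c: "set (nths xs S) \<subseteq> carrier_vec m" "set (nths xs (- S)) \<subseteq> carrier_vec m"
    using set_nths_carrier[OF car] by auto
  have il: "i < length xs" "Suc i < length xs" using i len by auto
  have adjacent: "card {j\<in>T. j < Suc i} = Suc (card {j\<in>T. j < i})" if "i \<in> T" for T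
  proof -
    have "{j\<in>T. j < Suc i} = insert i {j\<in>T. j < i}" using that by auto
    then show ?thesis by simp
  qed
  show ?thesis
  proof (cases "i \<in> S")
    case True
    then have T2: "Suc i \<in> S" using together by simp
    with True have "\<alpha> (nths xs S) = 0"
      using nth_nths_card_less[OF True il(1)] nth_nths_card_less[OF T2 il(2)] adjacent[OF True] i(2)
      by (intro alternating_adjacent_eq[OF a l1 c(1), of "card {j\<in>S. j < i}"]) (auto simp: l1)
    then show ?thesis unfolding shuffle_term_def by simp
  next
    case False
    then have T: "i \<in> - S" "Suc i \<in> - S" using together by auto
    then have "\<beta> (nths xs (- S)) = 0"
      using nth_nths_card_less[OF T(1) il(1)] nth_nths_card_less[OF T(2) il(2)] adjacent[OF T(1)] i(2)
      by (intro alternating_adjacent_eq[OF b l2 c(2), of "card {j\<in>- S. j < i}"]) (auto simp: l2)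
    then show ?thesis unfolding shuffle_term_def by simp
  qed
qed

lemma shuffle_term_adj_swap:
  assumes i: "Suc i < length xs" "xs ! i = xs ! Suc i"
    and S: "finite S" "card S = p" and apart: "(i \<in> S) \<noteq> (Suc i \<in> S)"
  shows "shuffle_term p \<alpha> \<beta> xs (adj_swap i -` S) = - shuffle_term p \<alpha> \<beta> xs S"
proof -
  have "inj_on (adj_swap i) S" by (metis inj_onI adj_swap_adj_swap)
  then have T: "finite (adj_swap i ` S)" "card (adj_swap i ` S) = p" using S by (auto simp: card_image)
  have "nths xs (adj_swap i -` S) = nths xs S" "nths xs (- (adj_swap i -` S)) = nths xs (- S)"
    using nths_vimage_adj_swap[OF i] by (auto simp: vimage_Compl[symmetric])
  then show ?thesis
    unfolding shuffle_term_def power_minus_one_sum_shuffle[OF S]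
    unfolding vimage_adj_swap power_minus_one_sum_shuffle[OF T] power_minus_one_sum_adj_swap[OF S(1) apart]
    by simp
qed

lemma alternating_wedgeF:
  assumes a: "alternating m p \<alpha>" and b: "alternating m q \<beta>"
  shows "alternating m (p + q) (wedgeF p \<alpha> \<beta>)"
proof (rule alternatingI)
  fix xs :: "rat vec list" and k and u v :: "rat vec"
  assume h: "length xs = p + q" "set xs \<subseteq> carrier_vec m" "k < p + q" "u \<in> carrier_vec m" "v \<in> carrier_vec m"
  then show "wedgeF p \<alpha> \<beta> (xs[k := u + v]) = wedgeF p \<alpha> \<beta> (xs[k := u]) + wedgeF p \<alpha> \<beta> (xs[k := v])"
    unfolding wedgeF_eq_sum_shuffle_term using shuffle_term_linear(1)[OF a b h(1,2) _ _ h(3,4,5)]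
    by (simp add: sum.distrib[symmetric])
next
  fix xs :: "rat vec list" and k and u :: "rat vec" and c
  assume h: "length xs = p + q" "set xs \<subseteq> carrier_vec m" "k < p + q" "u \<in> carrier_vec m"
  then show "wedgeF p \<alpha> \<beta> (xs[k := c \<cdot>\<^sub>v u]) = c * wedgeF p \<alpha> \<beta> (xs[k := u])"
    unfolding wedgeF_eq_sum_shuffle_term using shuffle_term_linear(2)[OF a b h(1,2) _ _ h(3,4,4)]
    by (simp add: sum_distrib_left)
next
  fix xs :: "rat vec list" and i
  assume h: "length xs = p + q" "set xs \<subseteq> carrier_vec m" "Suc i < p + q" "xs ! i = xs ! Suc i"
  define SS where "SS = {S. S \<subseteq> {..<p + q} \<and> card S = p}"
  define E where "E = {S\<in>SS. (i \<in> S) \<noteq> (Suc i \<in> S)}"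
  \<comment> \<open>terms keeping \<open>i\<close>, \<open>Suc i\<close> in the same factor vanish; the others cancel in pairs under the swap\<close>
  have swap_E: "adj_swap i -` S \<in> E" if "S \<in> E" for S
  proof -
    have "inj_on (adj_swap i) S" by (metis inj_onI adj_swap_adj_swap)
    then have "card (adj_swap i ` S) = card S" by (rule card_image)
    moreover have "adj_swap i ` S \<subseteq> {..<p + q}" "(i \<in> adj_swap i ` S) \<noteq> (Suc i \<in> adj_swap i ` S)"
      using that h(3) unfolding E_def SS_def by (auto simp: adj_swap_def image_iff split: if_splits)
    ultimately show ?thesis using that unfolding E_def SS_def vimage_adj_swap mem_Collect_eq by argo
  qed
  have "(\<Sum>S\<in>E. shuffle_term p \<alpha> \<beta> xs S) = (\<Sum>S\<in>E. shuffle_term p \<alpha> \<beta> xs (adj_swap i -` S))"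
    by (rule sum.reindex_bij_witness[of _ "\<lambda>S. adj_swap i -` S" "\<lambda>S. adj_swap i -` S"])
      (simp_all only: swap_E vimage_vimage_adj_swap)
  also have "\<dots> = - (\<Sum>S\<in>E. shuffle_term p \<alpha> \<beta> xs S)"
    using h by (auto simp: sum_negf[symmetric] E_def SS_def finite_subset intro!: sum.cong shuffle_term_adj_swap)
  finally have "(\<Sum>S\<in>E. shuffle_term p \<alpha> \<beta> xs S) = 0" by simp
  moreover have "shuffle_term p \<alpha> \<beta> xs S = 0" if "S \<in> SS - E" for S
    using that by (intro shuffle_term_zero_if_adjacent_together[OF a b h(1,2)]) (use h in \<open>auto simp: E_def SS_def\<close>)
  then have "(\<Sum>S\<in>SS - E. shuffle_term p \<alpha> \<beta> xs S) = 0" by simp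
  moreover have "E \<subseteq> SS" "finite SS" unfolding E_def SS_def using finite_shuffles by auto
  ultimately show "wedgeF p \<alpha> \<beta> xs = 0"
    unfolding wedgeF_eq_sum_shuffle_term SS_def[symmetric] h(1) by (metis add.left_neutral sum.subset_diff)
qed

definition vanishes_with :: "nat \<Rightarrow> nat \<Rightarrow> (rat vec list \<Rightarrow> rat) \<Rightarrow> rat vec \<Rightarrow> bool" where
  "vanishes_with m n \<theta> v \<longleftrightarrow> (\<forall>us. length us = n \<longrightarrow> set us \<subseteq> carrier_vec m \<longrightarrow> v \<in> set us \<longrightarrow> \<theta> us = 0)"

lemma vanishes_withD:
  "vanishes_with m n \<theta> v \<Longrightarrow> length us = n \<Longrightarrow> set us \<subseteq> carrier_vec m \<Longrightarrow> v \<in> set us \<Longrightarrow> \<theta> us = 0"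
  unfolding vanishes_with_def by blast

lemma vanishes_with_wedgeF:
  assumes "vanishes_with m p \<alpha> v" "vanishes_with m q \<beta> v"
  shows "vanishes_with m (p + q) (wedgeF p \<alpha> \<beta>) v"
  unfolding vanishes_with_def wedgeF_eq_sum_shuffle_term
proof (intro allI impI sum.neutral ballI)
  fix us S
  assume us: "length us = p + q" "set us \<subseteq> carrier_vec m" "v \<in> set us"
    and S: "S \<in> {S. S \<subseteq> {..<length us} \<and> card S = p}"
  obtain t where t: "t < length us" "us ! t = v" using us(3) by (auto simp: in_set_conv_nth)
  have "length (nths us S) = p" "length (nths us (- S)) = q"
    using S us(1) by (auto simp: length_nths_subset length_nths_Compl)
  moreover have "v \<in> set (nths us S) \<or> v \<in> set (nths us (- S))"
    using t by (cases "t \<in> S") (auto simp: set_nths)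
  ultimately show "shuffle_term p \<alpha> \<beta> us S = 0"
    using assms set_nths_carrier[OF us(2)] unfolding shuffle_term_def
    by (auto dest: vanishes_withD)
qed

lemma wedgeF_append_if_other_terms_vanish:
  assumes len: "length xs = p" "length ys = q"
    and others: "\<And>S. S \<subseteq> {..<p + q} \<Longrightarrow> card S = p \<Longrightarrow> S \<noteq> {..<p} \<Longrightarrow>
      \<alpha> (nths (xs @ ys) S) = 0 \<or> \<beta> (nths (xs @ ys) (- S)) = 0"
  shows "wedgeF p \<alpha> \<beta> (xs @ ys) = \<alpha> xs * \<beta> ys"
proof -
  have "wedgeF p \<alpha> \<beta> (xs @ ys) = (\<Sum>S\<in>{{..<p}}. shuffle_term p \<alpha> \<beta> (xs @ ys) S)"
    unfolding wedgeF_eq_sum_shuffle_term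
  proof (rule sum.mono_neutral_right[OF finite_shuffles])
    show "{{..<p}} \<subseteq> {S. S \<subseteq> {..<length (xs @ ys)} \<and> card S = p}" using len by auto
    show "\<forall>S\<in>{S. S \<subseteq> {..<length (xs @ ys)} \<and> card S = p} - {{..<p}}. shuffle_term p \<alpha> \<beta> (xs @ ys) S = 0"
    proof
      fix S assume "S \<in> {S. S \<subseteq> {..<length (xs @ ys)} \<and> card S = p} - {{..<p}}"
      then have "S \<subseteq> {..<p + q}" "card S = p" "S \<noteq> {..<p}" using len by auto
      from others[OF this] show "shuffle_term p \<alpha> \<beta> (xs @ ys) S = 0" unfolding shuffle_term_def by auto
    qed
  qed
  moreover have "nths (xs @ ys) {..<p} = xs" "nths (xs @ ys) (- {..<p}) = ys"
  proof -
    have "- {..<p} = {i. p \<le> i}" by auto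
    then show "nths (xs @ ys) {..<p} = xs" "nths (xs @ ys) (- {..<p}) = ys"
      using len drop_eq_nths[of p "xs @ ys"] by simp_all
  qed
  moreover have "\<Sum>{..<p} = p * (p - 1) div 2"
    using Sum_Ico_nat[of 0 p] by (simp add: lessThan_atLeast0)
  ultimately show ?thesis unfolding shuffle_term_def by simp
qed

lemma wedgeF_append_if_right_vanishes:
  assumes len: "length xs = p" "length ys = q" and car: "set (xs @ ys) \<subseteq> carrier_vec m"
    and vanish: "\<And>v. v \<in> set xs \<Longrightarrow> vanishes_with m q \<beta> v"
  shows "wedgeF p \<alpha> \<beta> (xs @ ys) = \<alpha> xs * \<beta> ys"
proof (rule wedgeF_append_if_other_terms_vanish[OF len])
  fix S assume S: "S \<subseteq> {..<p + q}" "card S = p" "S \<noteq> {..<p}"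
  \<comment> \<open>some entry of \<open>xs\<close> is moved into the second factor\<close>
  obtain s where s: "s < p" "s \<notin> S"
  proof (rule ccontr)
    assume "\<not> thesis"
    then have "{..<p} \<subseteq> S" using that by auto
    then show False using S card_subset_eq[of S "{..<p}"] finite_subset[OF S(1)] by auto
  qed
  then have "xs ! s \<in> set (nths (xs @ ys) (- S))" "xs ! s \<in> set xs"
    using len by (auto simp: set_nths nth_append intro!: exI[of _ s])
  moreover have "length (nths (xs @ ys) (- S)) = q" using S len by (simp add: length_nths_Compl)
  ultimately show "\<alpha> (nths (xs @ ys) S) = 0 \<or> \<beta> (nths (xs @ ys) (- S)) = 0"
    using vanish set_nths_carrier[OF car] by (auto dest: vanishes_withD)
qed

lemma wedgeF_append_if_left_vanishes:
  assumes len: "length xs = p" "length ys = q" and car: "set (xs @ ys) \<subseteq> carrier_vec m"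
    and vanish: "\<And>v. v \<in> set ys \<Longrightarrow> vanishes_with m p \<alpha> v"
  shows "wedgeF p \<alpha> \<beta> (xs @ ys) = \<alpha> xs * \<beta> ys"
proof (rule wedgeF_append_if_other_terms_vanish[OF len])
  fix S assume S: "S \<subseteq> {..<p + q}" "card S = p" "S \<noteq> {..<p}"
  \<comment> \<open>some entry of \<open>ys\<close> is moved into the first factor\<close>
  obtain s where s: "s \<in> S" "p \<le> s"
  proof (rule ccontr)
    assume "\<not> thesis"
    then have "S \<subseteq> {..<p}" using that by force
    then show False using S card_subset_eq[of "{..<p}" S] by auto
  qed
  then have "ys ! (s - p) \<in> set (nths (xs @ ys) S)" "ys ! (s - p) \<in> set ys"
    using S len by (auto simp: set_nths nth_append intro!: exI[of _ s])
  moreover have "length (nths (xs @ ys) S) = p" using S len by (simp add: length_nths_subset)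
  ultimately show "\<alpha> (nths (xs @ ys) S) = 0 \<or> \<beta> (nths (xs @ ys) (- S)) = 0"
    using vanish set_nths_carrier[OF car] by (auto dest: vanishes_withD)
qed

lemma det_unit_vecs_update:
  fixes v :: "rat vec"
  assumes v: "v \<in> carrier_vec m" and t: "t < m"
  shows "det (mat_of_cols m ((unit_vecs m)[t := v])) = v $ t"
proof -
  let ?e = "unit_vecs m :: rat vec list"
  have e: "length ?e = m" "set ?e \<subseteq> carrier_vec m" by (auto simp: unit_vecs_def)
  have "det (mat_of_cols m (?e[t := unit_vec m j])) = (if j = t then 1 else 0)" if "j < m" for j
  proof (cases "j = t")
    case True
    have "?e ! t = unit_vec m t" using t by (simp add: unit_vecs_def)
    then have "?e[t := unit_vec m t] = ?e" by (metis list_update_id)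
    then show ?thesis using True by (simp add: det_unit_vecs)
  next
    case False
    have "det (mat_of_cols m (?e[t := unit_vec m j])) = 0"
      using False that t e
      by (intro alternating_repeated_arg[OF alternating_det, where i=t and j=j])
        (auto simp: unit_vecs_def nth_list_update dest!: subsetD[OF set_update_subset_insert])
    then show ?thesis using False by simp
  qed
  then have "det (mat_of_cols m (?e[t := v])) = (\<Sum>j<m. v $ j * (if j = t then 1 else 0))"
    using alternating_unit_vec_expansion[OF alternating_det e t v] by simp
  also have "\<dots> = (\<Sum>j<m. if j = t then v $ j else 0)" by (rule sum.cong) auto
  finally show ?thesis using t by simp
qed

lemma alternating_top_degree_eq_zero:
  assumes alt: "alternating m m \<psi>" and "vanishes_with m m \<psi> v"
    and v: "v \<in> carrier_vec m" "v \<noteq> 0\<^sub>v m"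
  shows "\<psi> (unit_vecs m) = 0"
proof -
  obtain t where t: "t < m" "v $ t \<noteq> 0" using v by (metis carrier_vecD eq_vecI index_zero_vec)
  let ?e = "(unit_vecs m)[t := v]"
  have e: "length ?e = m" "set ?e \<subseteq> carrier_vec m" "v \<in> set ?e"
    using t v by (auto simp: unit_vecs_def set_update_memI dest!: subsetD[OF set_update_subset_insert])
  have "v $ t * \<psi> (unit_vecs m) = \<psi> ?e"
    using alternating_top_degree[OF alt e(1,2)] det_unit_vecs_update[OF v(1) t(1)] by simp
  also have "\<dots> = 0" using assms(2) e by (rule vanishes_withD)
  finally show ?thesis using t by simp
qed

section \<open>Spans, independence and coordinates\<close>

lemma mat_of_cols_map_mult:
  assumes "set us \<subseteq> carrier_vec m" "set cs \<subseteq> carrier_vec (length us)"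
  shows "mat_of_cols m (map ((*\<^sub>v) (mat_of_cols m us)) cs) = mat_of_cols m us * mat_of_cols (length us) cs"
  using assms by (intro eq_matI) (auto simp: mat_of_cols_index subsetD)

lemma in_span_coords:
  assumes "\<And>w. w \<in> set ws \<Longrightarrow> in_span m us w"
  obtains cs where "length cs = length ws" "set cs \<subseteq> carrier_vec (length us)"
    "ws = map ((*\<^sub>v) (mat_of_cols m us)) cs"
proof -
  have "\<forall>j<length ws. \<exists>c. c \<in> carrier_vec (length us) \<and> ws ! j = mat_of_cols m us *\<^sub>v c"
    using assms unfolding in_span_def by (metis nth_mem)
  then obtain c where c: "\<And>j. j < length ws \<Longrightarrow> c j \<in> carrier_vec (length us) \<and> ws ! j = mat_of_cols m us *\<^sub>v c j"
    by metis
  show ?thesis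
    by (rule that[of "map c [0..<length ws]"], insert c, auto intro: nth_equalityI)
qed

lemma in_span_trans:
  assumes v: "in_span m ws v" and ws: "\<And>w. w \<in> set ws \<Longrightarrow> in_span m us w"
    and us: "set us \<subseteq> carrier_vec m"
  shows "in_span m us v"
proof -
  obtain x where x: "x \<in> carrier_vec (length ws)" "v = mat_of_cols m ws *\<^sub>v x" "v \<in> carrier_vec m"
    using v unfolding in_span_def by auto
  obtain cs where cs: "length cs = length ws" "set cs \<subseteq> carrier_vec (length us)"
    "ws = map ((*\<^sub>v) (mat_of_cols m us)) cs"
    by (rule in_span_coords[OF ws])
  have B: "mat_of_cols (length us) cs \<in> carrier_mat (length us) (length ws)"
    using mat_of_cols_carrier(1)[of "length us" cs] cs(1) by simp
  have "v = (mat_of_cols m us * mat_of_cols (length us) cs) *\<^sub>v x"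
    using x(2) mat_of_cols_map_mult[OF us cs(2)] by (simp add: cs(3)[symmetric])
  then have "v = mat_of_cols m us *\<^sub>v (mat_of_cols (length us) cs *\<^sub>v x)"
    using assoc_mult_mat_vec[OF mat_of_cols_carrier(1) B x(1)] by simp
  moreover have "mat_of_cols (length us) cs *\<^sub>v x \<in> carrier_vec (length us)"
    by (rule mult_mat_vec_carrier[OF B x(1)])
  ultimately show ?thesis unfolding in_span_def using x(3) by blast
qed

definition lin_indep_cols :: "nat \<Rightarrow> rat vec list \<Rightarrow> bool" where
  "lin_indep_cols m vs \<longleftrightarrow>
    (\<forall>x \<in> carrier_vec (length vs). mat_of_cols m vs *\<^sub>v x = 0\<^sub>v m \<longrightarrow> x = 0\<^sub>v (length vs))"

lemma det_nonzero_imp_lin_indep_cols: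
  assumes "length vs = m" "det (mat_of_cols m vs) \<noteq> 0"
  shows "lin_indep_cols m vs"
  using assms det_0_iff_vec_prod_zero_field[of "mat_of_cols m vs" m]
  unfolding lin_indep_cols_def by auto

lemma volV_nonzero_imp_lin_indep_cols:
  "volV m cw vs \<noteq> 0 \<Longrightarrow> length vs = m \<Longrightarrow> lin_indep_cols m vs"
  by (rule det_nonzero_imp_lin_indep_cols) (auto simp: volV_def)

lemma mat_of_cols_append_mult_vec:
  assumes "s \<in> carrier_vec (length xs)" "t \<in> carrier_vec (length ys)"
  shows "mat_of_cols m (xs @ ys) *\<^sub>v (s @\<^sub>v t) = mat_of_cols m xs *\<^sub>v s + mat_of_cols m ys *\<^sub>v t"
proof (rule eq_vecI)
  fix i assume "i < dim_vec (mat_of_cols m xs *\<^sub>v s + mat_of_cols m ys *\<^sub>v t)"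
  then have i: "i < m" by simp
  have "row (mat_of_cols m (xs @ ys)) i = row (mat_of_cols m xs) i @\<^sub>v row (mat_of_cols m ys) i"
    using i by (intro eq_vecI) (auto simp: mat_of_cols_index nth_append)
  then show "(mat_of_cols m (xs @ ys) *\<^sub>v (s @\<^sub>v t)) $ i = (mat_of_cols m xs *\<^sub>v s + mat_of_cols m ys *\<^sub>v t) $ i"
    using i assms by (simp add: scalar_prod_append[of _ "length xs" _ "length ys"])
qed simp

lemma mat_of_cols_mult_zero_vec: "mat_of_cols m vs *\<^sub>v 0\<^sub>v (length vs) = (0\<^sub>v m :: rat vec)"
  by (intro eq_vecI) auto

lemma lin_indep_cols_append:
  assumes indep: "lin_indep_cols m (xs @ ys)"
    and st: "s \<in> carrier_vec (length xs)" "t \<in> carrier_vec (length ys)"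
    and zero: "mat_of_cols m xs *\<^sub>v s + mat_of_cols m ys *\<^sub>v t = 0\<^sub>v m"
  shows "s = 0\<^sub>v (length xs) \<and> t = 0\<^sub>v (length ys)"
proof -
  have "s @\<^sub>v t \<in> carrier_vec (length (xs @ ys))" using st by auto
  moreover have "mat_of_cols m (xs @ ys) *\<^sub>v (s @\<^sub>v t) = 0\<^sub>v m"
    using mat_of_cols_append_mult_vec[OF st] zero by simp
  ultimately have st0: "s @\<^sub>v t = 0\<^sub>v (length xs + length ys)"
    using indep unfolding lin_indep_cols_def by simp
  have "s $ i = 0" if "i < length xs" for i
    using arg_cong[OF st0, of "\<lambda>w. w $ i"] that st by simp
  moreover have "t $ i = 0" if "i < length ys" for i
    using arg_cong[OF st0, of "\<lambda>w. w $ (length xs + i)"] that st by simp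
  ultimately show ?thesis using st by (auto intro!: eq_vecI)
qed

lemma lin_indep_cols_append_left: "lin_indep_cols m (xs @ ys) \<Longrightarrow> lin_indep_cols m xs"
  unfolding lin_indep_cols_def[of m xs]
  using lin_indep_cols_append[of m xs ys _ "0\<^sub>v (length ys)"] by (simp add: mat_of_cols_mult_zero_vec)

lemma lin_indep_cols_append_right: "lin_indep_cols m (xs @ ys) \<Longrightarrow> lin_indep_cols m ys"
  unfolding lin_indep_cols_def[of m ys]
  using lin_indep_cols_append[of m xs ys "0\<^sub>v (length xs)"] by (simp add: mat_of_cols_mult_zero_vec)

lemma lin_indep_cols_not_in_span:
  assumes indep: "lin_indep_cols m (pre @ us)" and car: "set (pre @ us) \<subseteq> carrier_vec m"
    and v: "v \<in> set us"
  shows "\<not> in_span m pre v"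
proof
  assume "in_span m pre v"
  then obtain y where y: "y \<in> carrier_vec (length pre)" "v = mat_of_cols m pre *\<^sub>v y"
    unfolding in_span_def by auto
  obtain k where k: "k < length us" "us ! k = v" using v by (auto simp: in_set_conv_nth)
  \<comment> \<open>the coefficients of \<open>v\<close> in \<open>pre\<close>, minus the \<open>k\<close>-th unit vector on \<open>us\<close>, lie in the kernel\<close>
  let ?e = "(-1::rat) \<cdot>\<^sub>v unit_vec (length us) k"
  have "mat_of_cols m us *\<^sub>v ?e = (-1) \<cdot>\<^sub>v v"
    using mat_of_cols_mult_unit_vec[of us m k] car k
    by (subst mult_mat_vec[of _ m "length us"]) auto
  then have ker: "mat_of_cols m pre *\<^sub>v y + mat_of_cols m us *\<^sub>v ?e = 0\<^sub>v m"
    using y car by (auto intro!: eq_vecI)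
  have "?e \<in> carrier_vec (length us)" by simp
  from lin_indep_cols_append[OF indep y(1) this ker] have "?e = 0\<^sub>v (length us)" by (rule conjunct2)
  then have "?e $ k = 0" using k by simp
  then show False using k by simp
qed

lemma volV_eq_zero_if_in_span:
  assumes "length (pre @ us) = m" "set (pre @ us) \<subseteq> carrier_vec m" "v \<in> set us" "in_span m pre v"
  shows "volV m cw (pre @ us) = 0"
proof (rule ccontr)
  assume "volV m cw (pre @ us) \<noteq> 0"
  then have "lin_indep_cols m (pre @ us)"
    using assms(1) by (intro det_nonzero_imp_lin_indep_cols) (auto simp: volV_def)
  then show False using lin_indep_cols_not_in_span assms(2-4) by blast
qed

lemma vanishes_with_star:
  assumes "set us \<subseteq> carrier_vec m" "length us + n = m" "in_span m us v"
  shows "vanishes_with m n (star m cw us) v"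
  unfolding vanishes_with_def star_def
proof (intro allI impI)
  fix ws assume "length ws = n" "set ws \<subseteq> carrier_vec m" "v \<in> set ws"
  then show "volV m cw (us @ ws) = 0"
    using assms by (intro volV_eq_zero_if_in_span[of us ws m v]) auto
qed

lemma alternating_star:
  "set us \<subseteq> carrier_vec m \<Longrightarrow> length us + n = m \<Longrightarrow> alternating m n (star m cw us)"
  unfolding star_def using alternating_volV[of us m "[]"] by simp

lemma vol_sub_mult_cols:
  assumes indep: "lin_indep_cols m B" and B: "set B \<subseteq> carrier_vec m"
    and cs: "length cs = length B" "set cs \<subseteq> carrier_vec (length B)"
  shows "vol_sub m B K (map ((*\<^sub>v) (mat_of_cols m B)) cs) = K * det (mat_of_cols (length B) cs)"
proof -
  let ?C = "mat_of_cols (length B) cs" and ?W = "map ((*\<^sub>v) (mat_of_cols m B)) cs"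
  have C: "?C \<in> carrier_mat (length B) (length B)" using cs by (metis mat_of_cols_carrier(1))
  have W: "mat_of_cols m ?W = mat_of_cols m B * ?C" by (rule mat_of_cols_map_mult[OF B cs(2)])
  \<comment> \<open>the coordinate matrix is unique because the columns of \<open>B\<close> are independent\<close>
  have "M = ?C" if M: "M \<in> carrier_mat (length B) (length ?W)" "mat_of_cols m ?W = mat_of_cols m B * M" for M
  proof (rule eq_matI)
    fix i j assume ij: "i < dim_row ?C" "j < dim_col ?C"
    have "mat_of_cols m B *\<^sub>v (col M j - col ?C j) = mat_of_cols m B *\<^sub>v col M j - mat_of_cols m B *\<^sub>v col ?C j"
      using M C ij by (intro mult_minus_distrib_mat_vec[of _ m "length B"]) auto
    also have "\<dots> = col (mat_of_cols m B * M) j - col (mat_of_cols m B * ?C) j"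
      using col_mult2[OF mat_of_cols_carrier(1) M(1), of j] col_mult2[OF mat_of_cols_carrier(1) C, of j] ij cs
      by simp
    also have "\<dots> = 0\<^sub>v m" using M(2) W by (intro eq_vecI) auto
    finally have "col M j - col ?C j = 0\<^sub>v (length B)"
      using indep M C ij cs unfolding lin_indep_cols_def by auto
    then have "(col M j - col ?C j) $ i = 0" using ij C by simp
    then show "M $$ (i, j) = ?C $$ (i, j)" using M C ij cs by simp
  qed (use that cs in auto)
  then have "(THE M. M \<in> carrier_mat (length B) (length ?W) \<and> mat_of_cols m ?W = mat_of_cols m B * M) = ?C"
    using C W cs by (intro the_equality) auto
  then show ?thesis unfolding vol_sub_def by simp
qed

lemma lin_indep_cols_append_span_inter:
  assumes "lin_indep_cols m (us @ ws)" "in_span m us v" "in_span m ws v"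
  shows "v = 0\<^sub>v m"
proof -
  obtain s t where s: "s \<in> carrier_vec (length us)" "v = mat_of_cols m us *\<^sub>v s"
    and t: "t \<in> carrier_vec (length ws)" "v = mat_of_cols m ws *\<^sub>v t" and v: "v \<in> carrier_vec m"
    using assms(2,3) unfolding in_span_def by auto
  have "mat_of_cols m ws *\<^sub>v ((-1) \<cdot>\<^sub>v t) = (-1) \<cdot>\<^sub>v v"
    using t by (subst mult_mat_vec[of _ m "length ws"]) auto
  then have ker: "mat_of_cols m us *\<^sub>v s + mat_of_cols m ws *\<^sub>v ((-1) \<cdot>\<^sub>v t) = 0\<^sub>v m"
    using s v by (auto intro!: eq_vecI)
  have "(-1) \<cdot>\<^sub>v t \<in> carrier_vec (length ws)" using t by simp
  from lin_indep_cols_append[OF assms(1) s(1) this ker] have "s = 0\<^sub>v (length us)" by (rule conjunct1)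
  then show ?thesis using s(2) mat_of_cols_mult_zero_vec by simp
qed

lemma lin_indep_cols_middle: "lin_indep_cols m (xs @ ys @ zs) \<Longrightarrow> lin_indep_cols m ys"
  by (metis lin_indep_cols_append_left lin_indep_cols_append_right)

lemma in_span_mult_vec: "x \<in> carrier_vec (length us) \<Longrightarrow> in_span m us (mat_of_cols m us *\<^sub>v x)"
  unfolding in_span_def using mult_mat_vec_carrier[OF mat_of_cols_carrier(1)] by blast

lemma in_span_add:
  assumes "in_span m us v" "in_span m us w"
  shows "in_span m us (v + w)"
proof -
  obtain s t where "s \<in> carrier_vec (length us)" "v = mat_of_cols m us *\<^sub>v s"
    "t \<in> carrier_vec (length us)" "w = mat_of_cols m us *\<^sub>v t"
    using assms unfolding in_span_def by auto
  then have "v + w = mat_of_cols m us *\<^sub>v (s + t)" by (simp add: mult_add_distrib_mat_vec[of _ m "length us"])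
  then show ?thesis using \<open>s \<in> carrier_vec (length us)\<close> \<open>t \<in> carrier_vec (length us)\<close>
    by (metis add_carrier_vec in_span_mult_vec)
qed

lemma mat_of_cols_append3_mult_vec:
  assumes "u \<in> carrier_vec (length xs + length ys + length zs)"
  obtains ux uy uz where "u = ux @\<^sub>v uy @\<^sub>v uz"
    "ux \<in> carrier_vec (length xs)" "uy \<in> carrier_vec (length ys)" "uz \<in> carrier_vec (length zs)"
    "mat_of_cols m (xs @ ys @ zs) *\<^sub>v u
      = mat_of_cols m xs *\<^sub>v ux + (mat_of_cols m ys *\<^sub>v uy + mat_of_cols m zs *\<^sub>v uz)"
proof -
  define r where "r = vec_last u (length ys + length zs)"
  define ux uy uz where "ux = vec_first u (length xs)" and "uy = vec_first r (length ys)"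
    and "uz = vec_last r (length zs)"
  have split: "u = ux @\<^sub>v uy @\<^sub>v uz" "ux \<in> carrier_vec (length xs)" "uy \<in> carrier_vec (length ys)"
    "uz \<in> carrier_vec (length zs)"
    using assms unfolding ux_def uy_def uz_def r_def by (auto simp: add.assoc)
  moreover have "uy @\<^sub>v uz \<in> carrier_vec (length (ys @ zs))" using split by auto
  ultimately show ?thesis
    using mat_of_cols_append_mult_vec[OF split(2)] mat_of_cols_append_mult_vec[OF split(3,4)] by (intro that) simp_all
qed

lemma lin_indep_cols_append_in_span:
  assumes "lin_indep_cols m (B @ ys)" "in_span m B w" "t \<in> carrier_vec (length ys)"
    "w + mat_of_cols m ys *\<^sub>v t = 0\<^sub>v m"
  shows "t = 0\<^sub>v (length ys)"
proof -
  obtain s where "s \<in> carrier_vec (length B)" "w = mat_of_cols m B *\<^sub>v s"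
    using assms(2) unfolding in_span_def by auto
  then show ?thesis using lin_indep_cols_append[OF assms(1) _ assms(3)] assms(4) by blast
qed

lemma dependent_columns_imp_common_vector:
  assumes len: "length xs + length ys + length zs = m"
    and car: "set B \<subseteq> carrier_vec m" and dep: "det (mat_of_cols m (xs @ ys @ zs)) = 0"
    and indep: "lin_indep_cols m xs" "lin_indep_cols m zs" "lin_indep_cols m (B @ ys)"
    and span: "\<And>v. v \<in> set xs \<Longrightarrow> in_span m B v" "\<And>v. v \<in> set zs \<Longrightarrow> in_span m B v"
  obtains v where "v \<noteq> 0\<^sub>v m" "in_span m xs v" "in_span m zs v"
proof -
  have "mat_of_cols m (xs @ ys @ zs) \<in> carrier_mat m m"
    using mat_of_cols_carrier(1)[of m "xs @ ys @ zs"] len by (simp add: add.assoc)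
  then obtain u where u: "u \<in> carrier_vec m" "u \<noteq> 0\<^sub>v m" "mat_of_cols m (xs @ ys @ zs) *\<^sub>v u = 0\<^sub>v m"
    using dep det_0_iff_vec_prod_zero_field by blast
  then obtain ux uy uz where split: "u = ux @\<^sub>v uy @\<^sub>v uz" "ux \<in> carrier_vec (length xs)"
    "uy \<in> carrier_vec (length ys)" "uz \<in> carrier_vec (length zs)"
    and sum0: "mat_of_cols m xs *\<^sub>v ux + (mat_of_cols m ys *\<^sub>v uy + mat_of_cols m zs *\<^sub>v uz) = 0\<^sub>v m"
    using mat_of_cols_append3_mult_vec[of u xs ys zs m] len by metis
  define X Y Z where "X = mat_of_cols m xs *\<^sub>v ux" and "Y = mat_of_cols m ys *\<^sub>v uy"
    and "Z = mat_of_cols m zs *\<^sub>v uz"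
  have XYZ: "X \<in> carrier_vec m" "Y \<in> carrier_vec m" "Z \<in> carrier_vec m"
    unfolding X_def Y_def Z_def by (auto intro!: carrier_vecI)
  have comp: "X $ i + Y $ i + Z $ i = 0" if "i < m" for i
    using arg_cong[OF sum0, of "\<lambda>w. w $ i"] that XYZ unfolding X_def Y_def Z_def by simp
  \<comment> \<open>the components in \<open>span B\<close> and in \<open>span ys\<close> vanish separately\<close>
  have "in_span m B (X + Z)"
    using in_span_trans[OF in_span_mult_vec[OF split(2)] span(1) car]
      in_span_trans[OF in_span_mult_vec[OF split(4)] span(2) car]
    unfolding X_def Z_def by (rule in_span_add)
  moreover have "(X + Z) + Y = 0\<^sub>v m" using comp XYZ by (intro eq_vecI) (auto simp: algebra_simps)
  ultimately have "uy = 0\<^sub>v (length ys)"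
    using lin_indep_cols_append_in_span[OF indep(3) _ split(3)] unfolding Y_def by blast
  then have "Y = 0\<^sub>v m" unfolding Y_def by (simp add: mat_of_cols_mult_zero_vec)
  then have XZ: "X $ i = - Z $ i" if "i < m" for i using comp[OF that] that by (simp add: eq_neg_iff_add_eq_0)
  show ?thesis
  proof (rule that)
    show "in_span m xs X" unfolding X_def by (rule in_span_mult_vec[OF split(2)])
    have "X = mat_of_cols m zs *\<^sub>v ((-1) \<cdot>\<^sub>v uz)"
      using XZ XYZ split(4) unfolding Z_def by (subst mult_mat_vec[of _ m "length zs"]) (auto intro!: eq_vecI)
    then show "in_span m zs X" using split(4) by (simp add: in_span_mult_vec)
    show "X \<noteq> 0\<^sub>v m"
    proof
      assume X0: "X = 0\<^sub>v m"
      then have "Z = 0\<^sub>v m" using XZ XYZ by (intro eq_vecI) auto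
      then have "ux = 0\<^sub>v (length xs)" "uz = 0\<^sub>v (length zs)"
        using indep(1,2) split X0 unfolding lin_indep_cols_def X_def Z_def by auto
      then show False using u(2) split(1) \<open>uy = 0\<^sub>v (length ys)\<close> len by auto
    qed
  qed
qed

section \<open>Decorated flags and their adapted bases\<close>

lemma pair_wedge_eq_det:
  assumes "length xs = k" "length phis = k" "set phis \<subseteq> carrier_vec m" "set xs \<subseteq> carrier_vec m"
  shows "pair_wedge xs phis = det (mat_of_cols k (map ((*\<^sub>v) (mat_of_rows m phis)) xs))"
proof -
  have "mat k k (\<lambda>(i, j). xs ! i \<bullet> phis ! j) = transpose_mat (mat_of_cols k (map ((*\<^sub>v) (mat_of_rows m phis)) xs))"
    using assms by (intro eq_matI) (auto simp: mat_of_cols_index mat_of_rows_index comm_scalar_prod[of _ m] subsetD)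
  then show ?thesis unfolding pair_wedge_def using assms by (metis det_transpose length_map mat_of_cols_carrier(1))
qed

lemma alternating_pair_wedge:
  assumes "length phis = k" "set phis \<subseteq> carrier_vec m"
  shows "alternating m k (\<lambda>xs. pair_wedge xs phis)"
proof (rule alternating_cong)
  show "alternating m k (\<lambda>xs. det (mat_of_cols k ([] @ map ((*\<^sub>v) (mat_of_rows m phis)) xs @ [])))"
    by (rule alternating_mult_mat_slice[OF alternating_det]) (use assms in auto)
qed (use assms in \<open>simp add: pair_wedge_eq_det\<close>)

lemma wedge_eq_alternating:
  assumes eq: "wedge_eq m vs us" and nz: "wedge_nonzero m us" and us: "length us = k" "vecs_in m us"
    and span: "\<And>v. v \<in> set vs \<Longrightarrow> in_span m us v" and alt: "alternating m k \<theta>"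
  shows "\<theta> vs = \<theta> us"
proof -
  have usc: "set us \<subseteq> carrier_vec m" using us unfolding vecs_in_def by auto
  obtain cs where cs: "length cs = k" "set cs \<subseteq> carrier_vec k" "vs = map ((*\<^sub>v) (mat_of_cols m us)) cs"
    using in_span_coords[OF span] eq us unfolding wedge_eq_def by metis
  \<comment> \<open>testing the equality against a form that does not vanish on \<open>us\<close> shows the coordinate change has determinant one\<close>
  obtain phis where phis: "length phis = k" "set phis \<subseteq> carrier_vec m" "pair_wedge us phis \<noteq> 0"
    using nz us unfolding wedge_nonzero_def vecs_in_def by auto
  have "pair_wedge vs phis = det (mat_of_cols k cs) * pair_wedge us phis"
    unfolding cs(3) by (rule alternating_mult_mat_cols[OF alternating_pair_wedge[OF phis(1,2)] us(1) usc cs(1,2)])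
  moreover have "pair_wedge vs phis = pair_wedge us phis"
    using eq phis us unfolding wedge_eq_def vecs_in_def by auto
  ultimately have "det (mat_of_cols k cs) = 1" using phis(3) by simp
  then show ?thesis
    using alternating_mult_mat_cols[OF alt us(1) usc cs(1,2)] unfolding cs(3) by simp
qed

lemma dflag_facts:
  assumes "dflag m cw D" "i \<le> m"
  shows "length (D i) = i" "set (D i) \<subseteq> carrier_vec m" "vecs_in m (D i)" "wedge_nonzero m (D i)"
  using assms unfolding dflag_def vecs_in_def by auto

lemma dflag_in_span_mono:
  assumes D: "dflag m cw D" and ij: "i \<le> j" "j \<le> m" and v: "in_span m (D i) v"
  shows "in_span m (D j) v"
  using ij
proof (induction j)
  case (Suc j)
  show ?case
  proof (cases "i = Suc j")
    case False
    then have "in_span m (D j) v" using Suc by auto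
    then show ?thesis
    proof (rule in_span_trans)
      show "in_span m (D (Suc j)) w" if "w \<in> set (D j)" for w
        using D Suc.prems that unfolding dflag_def by auto
      show "set (D (Suc j)) \<subseteq> carrier_vec m" using dflag_facts(2)[OF D Suc.prems(2)] .
    qed
  qed (use v in simp)
qed (use v in simp)

lemma alternating_take_basis_FG:
  assumes F: "dflag m cw F" and basis: "basis_FG m F G fl" and k: "k \<le> m" and alt: "alternating m k \<theta>"
  shows "\<theta> (take k fl) = \<theta> (F k)"
proof (cases "k = 0")
  case True
  then show ?thesis using dflag_facts(1)[OF F, of 0] by simp
next
  case False
  have fl: "length fl = m" using basis unfolding basis_FG_def by auto
  show ?thesis
  proof (rule wedge_eq_alternating[OF _ dflag_facts(4,1,3)[OF F k] _ alt])
    show "wedge_eq m (take k fl) (F k)" using basis False k unfolding basis_FG_def by auto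
    fix v assume "v \<in> set (take k fl)"
    then obtain j where j: "j < k" "v = fl ! j" using fl k by (auto simp: in_set_conv_nth)
    then have "in_span m (F (Suc j)) v" using basis k unfolding basis_FG_def by force
    then show "in_span m (F k) v" using dflag_in_span_mono[OF F, of "Suc j" k] j k by auto
  qed
qed

lemma alternating_rev_take_basis_GH:
  assumes H: "dflag m cw H" and basis: "basis_GH m G H hl" and k: "k \<le> m" and alt: "alternating m k \<theta>"
  shows "\<theta> (rev (take k hl)) = \<theta> (H k)"
proof (cases "k = 0")
  case True
  then show ?thesis using dflag_facts(1)[OF H, of 0] by simp
next
  case False
  have hl: "length hl = m" using basis unfolding basis_GH_def by auto
  show ?thesis
  proof (rule wedge_eq_alternating[OF _ dflag_facts(4,1,3)[OF H k] _ alt])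
    show "wedge_eq m (rev (take k hl)) (H k)" using basis False k unfolding basis_GH_def by auto
    fix v assume "v \<in> set (rev (take k hl))"
    then obtain j where j: "j < k" "v = hl ! j" using hl k by (auto simp: in_set_conv_nth)
    then have "in_span m (H (Suc j)) v" using basis k unfolding basis_GH_def by force
    then show "in_span m (H k) v" using dflag_in_span_mono[OF H, of "Suc j" k] j k by auto
  qed
qed

lemma basis_FG_in_span_G:
  assumes G: "dflag m cw G" and basis: "basis_FG m F G fl" and j: "b \<le> j" "j < m"
  shows "in_span m (G (m - b)) (fl ! j)"
proof -
  have "in_span m (G (m + 1 - Suc j)) (fl ! j)" using basis j unfolding basis_FG_def by force
  then show ?thesis using dflag_in_span_mono[OF G, of "m - j" "m - b"] j by auto
qed

lemma basis_GH_in_span_G: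
  assumes G: "dflag m cw G" and basis: "basis_GH m G H hl" and j: "b \<le> j" "j < m"
  shows "in_span m (G (m - b)) (hl ! j)"
proof -
  have "in_span m (G (m + 1 - Suc j)) (hl ! j)" using basis j unfolding basis_GH_def by force
  then show ?thesis using dflag_in_span_mono[OF G, of "m - j" "m - b"] j by auto
qed

section \<open>The dual coordinates of a generic triple\<close>

locale generic_flag_triple =
  fixes m :: nat and cw :: rat and F G H :: "nat \<Rightarrow> rat vec list" and fl hl :: "rat vec list"
  assumes F: "dflag m cw F" and G: "dflag m cw G" and H: "dflag m cw H"
    and generic: "generic_triple m cw F G H"
    and fl: "basis_FG m F G fl" and hl: "basis_GH m G H hl"
begin

lemma fl_carrier: "length fl = m" "set fl \<subseteq> carrier_vec m"
  using fl unfolding basis_FG_def vecs_in_def by auto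

lemma hl_carrier: "length hl = m" "set hl \<subseteq> carrier_vec m"
  using hl unfolding basis_GH_def vecs_in_def by auto

lemma fl_in_span_F: "j < k \<Longrightarrow> k \<le> m \<Longrightarrow> in_span m (F k) (fl ! j)"
  using fl dflag_in_span_mono[OF F, of "Suc j" k] unfolding basis_FG_def by force

lemma hl_in_span_H: "j < k \<Longrightarrow> k \<le> m \<Longrightarrow> in_span m (H k) (hl ! j)"
  using hl dflag_in_span_mono[OF H, of "Suc j" k] unfolding basis_GH_def by force

lemma volV_take_fl_append:
  "k + length us = m \<Longrightarrow> set us \<subseteq> carrier_vec m \<Longrightarrow> volV m cw (take k fl @ us) = volV m cw (F k @ us)"
  by (rule alternating_take_basis_FG[OF F fl, of k "\<lambda>vs. volV m cw (vs @ us)"])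
    (auto intro: alternating_volV[of "[]", simplified])

lemma volV_rev_take_hl_append:
  "k + length us = m \<Longrightarrow> set us \<subseteq> carrier_vec m \<Longrightarrow> volV m cw (rev (take k hl) @ us) = volV m cw (H k @ us)"
  by (rule alternating_rev_take_basis_GH[OF H hl, of k "\<lambda>vs. volV m cw (vs @ us)"])
    (auto intro: alternating_volV[of "[]", simplified])

lemma volV_append_rev_take_hl:
  "length us + k = m \<Longrightarrow> set us \<subseteq> carrier_vec m \<Longrightarrow> volV m cw (us @ rev (take k hl)) = volV m cw (us @ H k)"
  by (rule alternating_rev_take_basis_GH[OF H hl, of k "\<lambda>vs. volV m cw (us @ vs)"])
    (auto intro: alternating_volV[of _ _ "[]", simplified])

lemma lin_indep_fl: "lin_indep_cols m fl"
proof -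
  have "volV m cw fl = volV m cw (F m)"
    using volV_take_fl_append[of m "[]"] fl_carrier by simp
  then show ?thesis using F fl_carrier unfolding dflag_def by (intro volV_nonzero_imp_lin_indep_cols[of m cw]) auto
qed

lemma lin_indep_rev_hl: "lin_indep_cols m (rev hl)"
proof -
  have "volV m cw (rev hl) = volV m cw (H m)"
    using volV_rev_take_hl_append[of m "[]"] hl_carrier by simp
  then show ?thesis using H hl_carrier unfolding dflag_def by (intro volV_nonzero_imp_lin_indep_cols[of m cw]) auto
qed

lemma volV_F_G_nonzero: "b \<le> m \<Longrightarrow> volV m cw (F b @ G (m - b)) \<noteq> 0"
  using generic[unfolded generic_triple_def, rule_format, of b "m - b" 0] dflag_facts(1)[OF H, of 0] by simp

lemma volV_G_H_nonzero: "b \<le> m \<Longrightarrow> volV m cw (G (m - b) @ H b) \<noteq> 0"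
  using generic[unfolded generic_triple_def, rule_format, of 0 "m - b" b] dflag_facts(1)[OF F, of 0] by simp

context
  fixes a b c :: nat
  assumes abc: "a + b + c = m"
begin

text \<open>The paper's \<open>f_{(b)}\<close>, \<open>f_{b,(c)}\<close>, \<open>h_{(b)}\<close> and \<open>h_{(a),b}\<close>:\<close>

abbreviation "f_b \<equiv> take b fl"
abbreviation "f_b_c \<equiv> take c (drop b fl)"
abbreviation "h_b \<equiv> rev (take b hl)"
abbreviation "h_a_b \<equiv> rev (take a (drop b hl))"

lemma segment_facts:
  "length f_b = b" "length f_b_c = c" "length h_b = b" "length h_a_b = a"
  "set f_b \<subseteq> carrier_vec m" "set f_b_c \<subseteq> carrier_vec m" "set h_b \<subseteq> carrier_vec m" "set h_a_b \<subseteq> carrier_vec m"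
  "f_b @ f_b_c = take (m - a) fl" "h_a_b @ h_b = rev (take (m - c) hl)"
proof -
  have "m - a = b + c" "m - c = b + a" using abc by auto
  then show "f_b @ f_b_c = take (m - a) fl" "h_a_b @ h_b = rev (take (m - c) hl)"
    by (simp_all add: take_add)
qed (use fl_carrier hl_carrier abc in \<open>auto dest: in_set_takeD in_set_dropD\<close>)

lemma f_b_c_in_span:
  assumes "v \<in> set f_b_c"
  shows "in_span m (F (m - a)) v" "in_span m (G (m - b)) v"
proof -
  obtain j where j: "j < c" "v = fl ! (b + j)" using assms fl_carrier abc by (auto simp: in_set_conv_nth)
  have "b + j < m - a" "b + j < m" using j abc by auto
  then show "in_span m (F (m - a)) v" "in_span m (G (m - b)) v"
    using fl_in_span_F[of "b + j" "m - a"] basis_FG_in_span_G[OF G fl, of b "b + j"] j(2) by auto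
qed

lemma h_a_b_in_span:
  assumes "v \<in> set h_a_b"
  shows "in_span m (H (m - c)) v" "in_span m (G (m - b)) v"
proof -
  obtain j where j: "j < a" "v = hl ! (b + j)" using assms hl_carrier abc by (auto simp: in_set_conv_nth)
  have "b + j < m - c" "b + j < m" using j abc by auto
  then show "in_span m (H (m - c)) v" "in_span m (G (m - b)) v"
    using hl_in_span_H[of "b + j" "m - c"] basis_GH_in_span_G[OF G hl, of b "b + j"] j(2) by auto
qed

lemma Delta_s_eq_star:
  "Delta_s m cw F G H fl hl b c 0 a = star m cw (F (m - a)) h_a_b * star m cw (G (m - b)) h_b"
proof -
  let ?B = "G (m - b)" and ?W = "f_b_c @ h_a_b"
  have B: "length ?B = m - b" "set ?B \<subseteq> carrier_vec m" using dflag_facts[OF G, of "m - b"] by auto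
  have W: "length ?W = m - b" "set ?W \<subseteq> carrier_vec m" using segment_facts abc by auto
  have FB: "volV m cw (F b @ ?B) = volV m cw (f_b @ ?B)"
    using volV_take_fl_append[OF _ B(2), of b] B(1) abc by simp
  have BH: "volV m cw (?B @ H b) = volV m cw (?B @ h_b)"
    using volV_append_rev_take_hl[OF _ B(2), of b] B(1) abc by simp
  have "volV m cw (f_b @ ?B) \<noteq> 0" using volV_F_G_nonzero[of b] abc FB by simp
  then have "lin_indep_cols m (f_b @ ?B)"
    by (rule volV_nonzero_imp_lin_indep_cols) (use B(1) segment_facts(1) abc in simp)
  then have indep: "lin_indep_cols m ?B" by (rule lin_indep_cols_append_right)
  \<comment> \<open>\<open>\<Delta>\<close> is the determinant of the coordinates of \<open>f_{b,(c)} \<and> h_{(a),b}\<close> in the basis \<open>g_{(m-b)}\<close>\<close>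
  have "\<And>w. w \<in> set ?W \<Longrightarrow> in_span m ?B w" using f_b_c_in_span(2) h_a_b_in_span(2) by auto
  then obtain cs where cs: "length cs = length ?W" "set cs \<subseteq> carrier_vec (length ?B)"
    "?W = map ((*\<^sub>v) (mat_of_cols m ?B)) cs"
    by (rule in_span_coords)
  have "Delta_s m cw F G H fl hl b c 0 a = vol_sub m ?B (volV m cw (F b @ ?B) * volV m cw (?B @ H b)) ?W"
    unfolding Delta_s_def using dflag_facts(1)[OF G, of 0] by simp
  also have "\<dots> = volV m cw (F b @ ?B) * volV m cw (?B @ H b) * det (mat_of_cols (m - b) cs)"
    using vol_sub_mult_cols[OF indep B(2)] cs B(1) W(1) by simp
  finally have Delta: "Delta_s m cw F G H fl hl b c 0 a
      = volV m cw (f_b @ ?B) * volV m cw (?B @ h_b) * det (mat_of_cols (m - b) cs)"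
    unfolding FB BH .
  have "alternating m (m - b) (\<lambda>xs. volV m cw (f_b @ xs @ []))"
    using segment_facts(1,5) abc by (intro alternating_volV) auto
  moreover have "length cs = m - b" "set cs \<subseteq> carrier_vec (m - b)" using cs B(1) W(1) by auto
  ultimately have "volV m cw (f_b @ ?W) = det (mat_of_cols (m - b) cs) * volV m cw (f_b @ ?B)"
    using alternating_mult_mat_cols[OF _ B] unfolding cs(3) by simp
  moreover have fW: "f_b @ ?W = take (m - a) fl @ h_a_b" using segment_facts(9) by simp
  have "star m cw (F (m - a)) h_a_b = volV m cw (f_b @ ?W)"
    using volV_take_fl_append[of "m - a" h_a_b] segment_facts(4,8) abc unfolding star_def fW by simp
  ultimately show ?thesis unfolding Delta star_def by simp
qed

lemma lin_indep_h_a_b: "lin_indep_cols m h_a_b"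
proof -
  have "rev hl = rev (drop (m - c) hl) @ h_a_b @ h_b"
    using segment_facts(10) by (metis append_take_drop_id rev_append append_assoc)
  then show ?thesis using lin_indep_rev_hl lin_indep_cols_middle by metis
qed

lemma lin_indep_f_b_c: "lin_indep_cols m f_b_c"
proof -
  have "fl = f_b @ f_b_c @ drop (m - a) fl"
    using segment_facts(9) by (metis append_take_drop_id append_assoc)
  then show ?thesis using lin_indep_fl lin_indep_cols_middle by metis
qed

lemma lin_indep_G_h_b: "lin_indep_cols m (G (m - b) @ h_b)"
proof -
  have B: "length (G (m - b)) = m - b" "set (G (m - b)) \<subseteq> carrier_vec m" using dflag_facts[OF G, of "m - b"] by auto
  then have "volV m cw (G (m - b) @ h_b) = volV m cw (G (m - b) @ H b)"
    using volV_append_rev_take_hl[OF _ B(2), of b] abc by simp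
  then show ?thesis using volV_G_H_nonzero[of b] abc B segment_facts(3)
    by (intro volV_nonzero_imp_lin_indep_cols[of m cw]) auto
qed

lemma flag_complement_facts:
  "set (F (m - a)) \<subseteq> carrier_vec m" "length (F (m - a)) + a = m"
  "set (G (m - b)) \<subseteq> carrier_vec m" "length (G (m - b)) + b = m"
  "set (H (m - c)) \<subseteq> carrier_vec m" "length (H (m - c)) + c = m"
  using dflag_facts[OF F, of "m - a"] dflag_facts[OF G, of "m - b"] dflag_facts[OF H, of "m - c"] abc
  by auto

lemma alternating_dual_form:
  "alternating m m (wedgeF (a + b) (wedgeF a (star m cw (F (m - a))) (star m cw (G (m - b)))) (star m cw (H (m - c))))"
proof -
  have "alternating m (a + b + c) (wedgeF (a + b) (wedgeF a (star m cw (F (m - a))) (star m cw (G (m - b)))) (star m cw (H (m - c))))"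
    using flag_complement_facts by (intro alternating_wedgeF alternating_star) auto
  then show ?thesis using abc by simp
qed

lemma star_wedge_adapted:
  "wedgeF (a + b) (wedgeF a (star m cw (F (m - a))) (star m cw (G (m - b)))) (star m cw (H (m - c)))
      (h_a_b @ h_b @ f_b_c)
    = star m cw (F (m - a)) h_a_b * star m cw (G (m - b)) h_b * star m cw (H (m - c)) f_b_c"
proof -
  note F' = flag_complement_facts(1,2) and G' = flag_complement_facts(3,4)
  \<comment> \<open>\<open>h_{(a),b}\<close> lies in \<open>G_{m-b}\<close>, and \<open>f_{b,(c)}\<close> in \<open>F_{m-a} \<inter> G_{m-b}\<close>\<close>
  have "wedgeF a (star m cw (F (m - a))) (star m cw (G (m - b))) (h_a_b @ h_b)
      = star m cw (F (m - a)) h_a_b * star m cw (G (m - b)) h_b"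
  proof (rule wedgeF_append_if_right_vanishes)
    show "set (h_a_b @ h_b) \<subseteq> carrier_vec m" using segment_facts(7,8) by simp
    show "vanishes_with m b (star m cw (G (m - b))) v" if "v \<in> set h_a_b" for v
      by (rule vanishes_with_star[OF G' h_a_b_in_span(2)[OF that]])
  qed (rule segment_facts)+
  moreover have "wedgeF (a + b) (wedgeF a (star m cw (F (m - a))) (star m cw (G (m - b)))) (star m cw (H (m - c)))
      ((h_a_b @ h_b) @ f_b_c)
    = wedgeF a (star m cw (F (m - a))) (star m cw (G (m - b))) (h_a_b @ h_b) * star m cw (H (m - c)) f_b_c"
  proof (rule wedgeF_append_if_left_vanishes)
    show "length (h_a_b @ h_b) = a + b" using segment_facts(3,4) by simp
    show "set ((h_a_b @ h_b) @ f_b_c) \<subseteq> carrier_vec m" using segment_facts(6-8) by simp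
    show "vanishes_with m (a + b) (wedgeF a (star m cw (F (m - a))) (star m cw (G (m - b)))) v"
      if "v \<in> set f_b_c" for v
      by (rule vanishes_with_wedgeF vanishes_with_star[OF F'] vanishes_with_star[OF G']
          f_b_c_in_span[OF that])+
  qed (rule segment_facts)
  ultimately show ?thesis by (simp only: append_assoc)
qed

lemma star_H_f_b_c: "star m cw (H (m - c)) f_b_c = cw * det (mat_of_cols m (h_a_b @ h_b @ f_b_c))"
proof -
  have "star m cw (H (m - c)) f_b_c = volV m cw (rev (take (m - c) hl) @ f_b_c)"
    using volV_rev_take_hl_append[of "m - c" f_b_c] segment_facts(2,6) abc unfolding star_def by simp
  also have "rev (take (m - c) hl) @ f_b_c = h_a_b @ h_b @ f_b_c"
    by (simp only: segment_facts(10)[symmetric] append_assoc)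
  finally show ?thesis unfolding volV_def .
qed

lemma common_vector_if_degenerate:
  assumes "det (mat_of_cols m (h_a_b @ h_b @ f_b_c)) = 0"
  obtains v where "v \<in> carrier_vec m" "v \<noteq> 0\<^sub>v m" "in_span m h_a_b v"
    "in_span m (F (m - a)) v" "in_span m (G (m - b)) v" "in_span m (H (m - c)) v"
proof -
  have "length h_a_b + length h_b + length f_b_c = m" using segment_facts abc by simp
  then obtain v where v: "v \<noteq> 0\<^sub>v m" "in_span m h_a_b v" "in_span m f_b_c v"
    by (rule dependent_columns_imp_common_vector[OF _ flag_complement_facts(3) assms
        lin_indep_h_a_b lin_indep_f_b_c lin_indep_G_h_b h_a_b_in_span(2) f_b_c_in_span(2)])
  show ?thesis
  proof (rule that[OF _ v(1,2)])
    show "v \<in> carrier_vec m" using v(2) unfolding in_span_def by blast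
    show "in_span m (F (m - a)) v"
      by (rule in_span_trans[OF v(3) f_b_c_in_span(1) flag_complement_facts(1)])
    show "in_span m (G (m - b)) v"
      by (rule in_span_trans[OF v(3) f_b_c_in_span(2) flag_complement_facts(3)])
    show "in_span m (H (m - c)) v"
      by (rule in_span_trans[OF v(2) h_a_b_in_span(1) flag_complement_facts(5)])
  qed
qed

lemma dual_form_degenerate:
  assumes "det (mat_of_cols m (h_a_b @ h_b @ f_b_c)) = 0"
  shows "wedgeF (a + b) (wedgeF a (star m cw (F (m - a))) (star m cw (G (m - b)))) (star m cw (H (m - c)))
      (unit_vecs m) = 0"
    and "star m cw (F (m - a)) h_a_b = 0"
proof -
  obtain v where v: "v \<in> carrier_vec m" "v \<noteq> 0\<^sub>v m" "in_span m h_a_b v"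
    "in_span m (F (m - a)) v" "in_span m (G (m - b)) v" "in_span m (H (m - c)) v"
    using assms by (rule common_vector_if_degenerate)
  have "vanishes_with m (a + b) (wedgeF a (star m cw (F (m - a))) (star m cw (G (m - b)))) v"
    by (rule vanishes_with_wedgeF[OF vanishes_with_star[OF flag_complement_facts(1,2) v(4)]
          vanishes_with_star[OF flag_complement_facts(3,4) v(5)]])
  from vanishes_with_wedgeF[OF this vanishes_with_star[OF flag_complement_facts(5,6) v(6)]]
  show "wedgeF (a + b) (wedgeF a (star m cw (F (m - a))) (star m cw (G (m - b)))) (star m cw (H (m - c)))
      (unit_vecs m) = 0"
    using alternating_top_degree_eq_zero[OF alternating_dual_form _ v(1,2)] abc by simp
  show "star m cw (F (m - a)) h_a_b = 0"
  proof (rule ccontr)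
    assume "star m cw (F (m - a)) h_a_b \<noteq> 0"
    then have "lin_indep_cols m (F (m - a) @ h_a_b)"
      using flag_complement_facts(2) segment_facts(4) unfolding star_def
      by (intro volV_nonzero_imp_lin_indep_cols) auto
    then show False using lin_indep_cols_append_span_inter v(2-4) by blast
  qed
qed

lemma dual_form_unit_vecs:
  "wedgeF (a + b) (wedgeF a (star m cw (F (m - a))) (star m cw (G (m - b)))) (star m cw (H (m - c)))
      (unit_vecs m) = cw * (star m cw (F (m - a)) h_a_b * star m cw (G (m - b)) h_b)"
proof (cases "det (mat_of_cols m (h_a_b @ h_b @ f_b_c)) = 0")
  case False
  let ?\<psi> = "wedgeF (a + b) (wedgeF a (star m cw (F (m - a))) (star m cw (G (m - b)))) (star m cw (H (m - c)))"
    and ?d = "det (mat_of_cols m (h_a_b @ h_b @ f_b_c))"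
  have "length (h_a_b @ h_b @ f_b_c) = m" "set (h_a_b @ h_b @ f_b_c) \<subseteq> carrier_vec m"
    using segment_facts abc by auto
  from alternating_top_degree[OF alternating_dual_form this]
  have "?d * ?\<psi> (unit_vecs m) = ?\<psi> (h_a_b @ h_b @ f_b_c)" by simp
  also have "\<dots> = ?d * (cw * (star m cw (F (m - a)) h_a_b * star m cw (G (m - b)) h_b))"
    unfolding star_wedge_adapted star_H_f_b_c by (simp add: mult_ac)
  finally show ?thesis using mult_left_cancel[OF False] by blast
qed (simp add: dual_form_degenerate)

lemma Delta_dual_eq_Delta_s:
  assumes "cw \<noteq> 0"
  shows "Delta_dual m cw F G H a b c = Delta_s m cw F G H fl hl b c 0 a"
  using assms unfolding Delta_dual_def pair_omega_star_def dual_form_unit_vecs Delta_s_eq_star by simp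

end

end

theorem lemma6p25p15:
  fixes m :: nat and cw :: rat and F G H :: "nat \<Rightarrow> rat vec list"
    and fl hl :: "rat vec list" and a b c :: nat
  assumes "cw \<noteq> 0"
    and "dflag m cw F" and "dflag m cw G" and "dflag m cw H"
    and "generic_triple m cw F G H"
    and "basis_FG m F G fl" and "basis_GH m G H hl"
    and "a + b + c = m"
    and "(a, b, c) \<notin> {(m, 0, 0), (0, m, 0), (0, 0, m)}"
  shows "Delta_dual m cw F G H a b c = Delta_s m cw F G H fl hl b c 0 a"
proof -
  interpret generic_flag_triple m cw F G H fl hl
    using assms(2-7) by unfold_locales
  \<comment> \<open>the identity also holds in the three excluded corner cases\<close>
  show ?thesis by (rule Delta_dual_eq_Delta_s[OF assms(8,1)])
qed

end
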